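(* Let $\Gamma$ be a countably infinite discrete group. Suppose $(B_n)_{n\in\mathbb{N}}$ is a sequence of Borel complete sections in $\mathrm{Free}(2^\Gamma)$ and $(F_n)_{n\in\mathbb{N}}$ is a sequence of finite subsets of $\Gamma$ such that $\sup_{n\in\mathbb{N}}|F_n|=\infty$. Then there exists a point $x\in\mathrm{Free}(2^\Gamma)$ satisfying $x\in F_n\cdot B_n$ for infinitely many $n\in\mathbb{N}$.
   Context: The space $2^\Gamma$ of functions $x:\Gamma\to\{0,1\}$ has the product topology and the shift action $(\gamma\cdot x)(\delta)=x(\delta\gamma)$. $\mathrm{Free}(2^\Gamma)$ is the set of all points $x\in 2^\Gamma$ with trivial stabilizer; it is a shift-invariant $G_\delta$ subset of $2^\Gamma$. A complete section in $\mathrm{Free}(2^\Gamma)$ is a subset $B\subseteq\mathrm{Free}(2^\Gamma)$ that meets every $\Gamma$-orbit, i.e., $\Gamma\cdot B=\mathrm{Free}(2^\Gamma)$. For $F\subseteq\Gamma$, $F\cdot B=\{\sigma\cdot b:\sigma\in F,\ b\in B\}$. *)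

theory Defs
  imports "HOL-Analysis.Analysis"
begin

text \<open>
  Groups are rendered by the class \<^class>\<open>group_add\<close>, which is an arbitrary, not necessarily
  commutative, group written additively: \<open>a + b\<close> is the group product and \<open>0\<close> its identity.
  The space of functions from the group to \<open>{0, 1}\<close> is the type \<open>'g \<Rightarrow> bool\<close>; its topology from
  the library is the product of the discrete topologies on \<^typ>\<open>bool\<close>, and \<open>borel\<close> on this type
  is the corresponding Borel sigma-algebra.
\<close>

definition shift :: "'g::group_add \<Rightarrow> ('g \<Rightarrow> bool) \<Rightarrow> ('g \<Rightarrow> bool)" where
  "shift \<gamma> x = (\<lambda>\<delta>. x (\<delta> + \<gamma>))"

definition stabilizer :: "('g::group_add \<Rightarrow> bool) \<Rightarrow> 'g set" where
  "stabilizer x = {\<gamma>. shift \<gamma> x = x}"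

definition Free :: "('g::group_add \<Rightarrow> bool) set" where
  "Free = {x. stabilizer x = {0}}"

definition translates :: "'g::group_add set \<Rightarrow> ('g \<Rightarrow> bool) set \<Rightarrow> ('g \<Rightarrow> bool) set" where
  "translates F B = {shift \<sigma> b | \<sigma> b. \<sigma> \<in> F \<and> b \<in> B}"

definition complete_section :: "('g::group_add \<Rightarrow> bool) set \<Rightarrow> bool" where
  "complete_section B \<longleftrightarrow> B \<subseteq> Free \<and> translates UNIV B = Free"

end

theory Submission
  imports Defs
begin

text \<open>
  The proof builds one free point \<open>x\<close> that is recurrent in a very strong sense and then argues by
  Baire category in its orbit closure \<open>X\<close>.

  The recurrence (\<open>exists_universally_recurrent_point\<close>) says: for every finite \<open>W\<close>, every \<open>\<delta>\<close> and every
  \<open>n0\<close> there is \<open>n \<ge> n0\<close> such that from every \<open>y \<in> X\<close> some \<open>g \<in> F n\<close> makes \<open>\<delta> + g\<close> bring \<open>y\<close> back to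
  the values of \<open>x\<close> on \<open>W\<close>. Hence every nonempty relatively open \<open>U \<subseteq> X\<close> has arbitrarily large \<open>n\<close>
  for which the set \<open>F n \<cdot> y\<close> meets \<open>U\<close> for all \<open>y \<in> X\<close>. Suppose now that each free point lies in
  only finitely many \<open>F n \<cdot> B n\<close>. The free points are comeager in \<open>X\<close>, because they form
  a \<open>G\<^sub>\<delta>\<close> set containing the dense orbit of \<open>x\<close>. So for some \<open>m\<close> the free points that lie in no
  \<open>F n \<cdot> B n\<close> with \<open>n \<ge> m\<close> form a nonmeager Borel set \<open>T\<close>, and \<open>T\<close> is comeager in some
  relatively open \<open>U\<close>. Take \<open>n \<ge> m\<close> for this \<open>U\<close> and a free \<open>z \<in> X\<close> whose whole orbit avoids the
  meager set \<open>U - T\<close>. The orbit of \<open>z\<close> meets \<open>B n\<close> in some \<open>b\<close>, and some \<open>g \<in> F n\<close> moves \<open>b\<close>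
  into \<open>U\<close>, hence into \<open>T\<close>; but \<open>g \<cdot> b \<in> F n \<cdot> B n\<close>, which contradicts the definition of \<open>T\<close>.

  The point \<open>x\<close> is the union of a chain of finite patterns. Once the \<open>i\<close>-th pattern \<open>s\<close> is known, a
  finite set \<open>E\<close> (a translate of some \<open>F n\<close>) is chosen that is huge compared with \<open>s\<close>, and from then on
  it is demanded that every window \<open>E + \<gamma>\<close> contains the position of a copy of \<open>s\<close>. A finite
  pattern can honour this only in windows that lie largely inside it. The right finite version is
  therefore: a copy occurs in each window of which a fixed fraction lies close to the domain of the pattern
  (\<open>saturated\<close>). The construction continues because saturation can be restored after
  a few points have been prescribed (\<open>extendable_insert\<close>): copies of \<open>s\<close> are scattered around the given
  pattern, well separated from it and from each other, and the older demands are then repaired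
  by induction on their number. Scattered copies are harmless for the older demands because each window
  of an older demand feels at most one of them.

  The positions of the scattered copies form a set that must meet every relevant window although its
  neighbourhood fills only a small part of each window (\<open>separated_sparse_hitting_set\<close>). A sparse random
  set violates each of these local constraints with a probability far below the reciprocal of the number
  of constraints that interact with it, and the counting version of the Local Lemma in
  \<open>avoiding_nonempty\<close> turns this into existence.
\<close>

section \<open>Avoiding local patterns by weighted counting\<close>

text \<open>
  A pair \<open>(D, B)\<close> encodes the forbidden event that a random set \<open>Q\<close> satisfies \<open>Q \<inter> D = B\<close>. Events
  whose support \<open>D\<close> is not contained in \<open>S\<close> are ignored, so that avoiding sets can be
  restricted to smaller \<open>S\<close>.
\<close>

definition avoiding :: "('a set \<times> 'a set) set \<Rightarrow> 'a set \<Rightarrow> 'a set set" where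
  "avoiding \<E> S = {Q. Q \<subseteq> S \<and> (\<forall>(D, B)\<in>\<E>. D \<subseteq> S \<longrightarrow> Q \<inter> D \<noteq> B)}"

text \<open>
  Up to normalisation, the probability of avoidance when each point is put into \<open>Q\<close>
  independently with probability \<open>1 / (a + 1)\<close>.
\<close>

definition avoiding_weight :: "real \<Rightarrow> ('a set \<times> 'a set) set \<Rightarrow> 'a set \<Rightarrow> real" where
  "avoiding_weight a \<E> S = (\<Sum>Q\<in>avoiding \<E> S. a ^ card (S - Q))"

lemma finite_avoiding: "finite S \<Longrightarrow> finite (avoiding \<E> S)"
  unfolding avoiding_def by (rule finite_subset[of _ "Pow S"]) auto

lemma avoiding_subset: "Q \<in> avoiding \<E> S \<Longrightarrow> Q \<subseteq> S"
  by (auto simp: avoiding_def)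

lemma avoiding_Int:
  assumes "Q \<in> avoiding \<E> S" "T \<subseteq> S"
  shows "Q \<inter> T \<in> avoiding \<E> T"
proof -
  have "Q \<inter> T \<inter> D \<noteq> B" if "(D, B) \<in> \<E>" "D \<subseteq> T" for D B
  proof -
    have "Q \<inter> T \<inter> D = Q \<inter> D" using that by auto
    moreover have "Q \<inter> D \<noteq> B" using that assms by (force simp: avoiding_def)
    ultimately show ?thesis by simp
  qed
  then show ?thesis by (auto simp: avoiding_def)
qed

text \<open>
  A violating set is fixed on \<open>D\<close>, and what is left of it outside \<open>D\<close> still avoids
  all events supported there.
\<close>

lemma avoiding_weight_violating_le:
  assumes "finite S" "v \<notin> S" "v \<in> D" "D \<subseteq> insert v S" "a > 0"
  shows "(\<Sum>Q\<in>{Q. Q \<subseteq> insert v S \<and> Q \<inter> S \<in> avoiding \<E> S \<and> Q \<inter> D = B}. a ^ card (insert v S - Q))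
           \<le> a ^ card (D - B) * avoiding_weight a \<E> (S - D)" (is "sum _ ?X \<le> _")
proof -
  have fX: "finite ?X" using assms(1) by (rule_tac finite_subset[of _ "Pow (insert v S)"]) auto
  have inj: "inj_on (\<lambda>Q. Q - D) ?X" by (rule inj_onI) blast
  have img: "(\<lambda>Q. Q - D) ` ?X \<subseteq> avoiding \<E> (S - D)"
  proof (rule image_subsetI)
    fix Q assume "Q \<in> ?X"
    then have "Q \<inter> S \<inter> (S - D) \<in> avoiding \<E> (S - D)" by (intro avoiding_Int) auto
    moreover have "Q \<inter> S \<inter> (S - D) = Q - D" using \<open>Q \<in> ?X\<close> assms(3) by auto
    ultimately show "Q - D \<in> avoiding \<E> (S - D)" by simp
  qed
  have w: "a ^ card (insert v S - Q) = a ^ card (D - B) * a ^ card ((S - D) - (Q - D))" if "Q \<in> ?X" for Q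
  proof -
    have "insert v S - Q = (D - B) \<union> ((S - D) - (Q - D))" using that assms(3,4) by auto
    moreover have "finite (D - B)" using assms(1,4) by (meson finite.insertI finite_Diff finite_subset)
    moreover have "(D - B) \<inter> ((S - D) - (Q - D)) = {}" by auto
    ultimately have "card (insert v S - Q) = card (D - B) + card ((S - D) - (Q - D))"
      using assms(1) by (simp add: card_Un_disjoint)
    then show ?thesis by (simp add: power_add)
  qed
  have "(\<Sum>Q\<in>?X. a ^ card (insert v S - Q)) = (\<Sum>Q\<in>?X. a ^ card (D - B) * a ^ card ((S - D) - (Q - D)))"
    by (intro sum.cong refl w)
  also have "\<dots> = a ^ card (D - B) * (\<Sum>R\<in>(\<lambda>Q. Q - D) ` ?X. a ^ card ((S - D) - R))"
    by (simp add: sum.reindex[OF inj] sum_distrib_left)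
  also have "\<dots> \<le> a ^ card (D - B) * avoiding_weight a \<E> (S - D)"
    unfolding avoiding_weight_def using assms
    by (intro mult_left_mono sum_mono2 img finite_avoiding) auto
  finally show ?thesis .
qed

text \<open>
  The inductive step of Rosenfeld's counting argument. Without the events through \<open>v\<close>, adding \<open>v\<close>
  multiplies the weight by \<open>a + 1\<close>. An event \<open>(D, B)\<close> through \<open>v\<close> spoils at most \<open>a ^ card (D - B)\<close> times
  the weight of \<open>S - D\<close>, and the growth already known makes the latter at most the fraction
  \<open>\<beta> / \<beta> ^ card D\<close> of the weight of \<open>S\<close>. The assumption on \<open>v\<close> bounds the total loss.
\<close>

lemma avoiding_weight_insert:
  assumes S: "finite S" "v \<notin> S" and fin: "finite \<E>" and a: "a > 0" and \<beta>: "\<beta> > 0"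
    and charge: "(\<Sum>(D, B)\<in>{(D, B)\<in>\<E>. v \<in> D}. a ^ card (D - B) * \<beta> / \<beta> ^ card D) \<le> a + 1 - \<beta>"
    and IH: "\<And>T. T \<subseteq> S \<Longrightarrow> \<beta> ^ card (S - T) * avoiding_weight a \<E> T \<le> avoiding_weight a \<E> S"
  shows "\<beta> * avoiding_weight a \<E> S \<le> avoiding_weight a \<E> (insert v S)"
proof -
  let ?w = "avoiding_weight a \<E>"
  define G where "G = avoiding \<E> S"
  define X where "X = {Q. Q \<subseteq> insert v S \<and> Q \<inter> S \<in> G}"
  define wt where "wt Q = a ^ card (insert v S - Q)" for Q
  define bad where "bad = (\<lambda>(D, B). {Q. Q \<subseteq> insert v S \<and> Q \<inter> S \<in> avoiding \<E> S \<and> Q \<inter> D = B})"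
  define \<E>v where "\<E>v = {(D, B)\<in>\<E>. v \<in> D}"
  define \<E>S where "\<E>S = {(D, B)\<in>\<E>. v \<in> D \<and> D \<subseteq> insert v S}"
  have fEv: "finite \<E>v" unfolding \<E>v_def using fin by (rule rev_finite_subset) auto
  have ES: "\<E>S \<subseteq> \<E>v" by (auto simp: \<E>S_def \<E>v_def)
  have fES: "finite \<E>S" using fEv ES by (rule rev_finite_subset)
  have fX: "finite X" unfolding X_def using S by (rule_tac finite_subset[of _ "Pow (insert v S)"]) auto
  have fG: "finite G" unfolding G_def using S by (simp add: finite_avoiding)
  have vG: "v \<notin> Q" "Q \<subseteq> S" "finite Q" if "Q \<in> G" for Q
    using that S avoiding_subset[of Q \<E> S] finite_subset by (auto simp: G_def)
  have w0: "?w S \<ge> 0" unfolding avoiding_weight_def using a by (intro sum_nonneg) simp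
  have sumX: "sum wt X = (a + 1) * ?w S"
  proof -
    have X: "X = G \<union> insert v ` G"
    proof (intro equalityI subsetI)
      fix Q assume Q: "Q \<in> X"
      show "Q \<in> G \<union> insert v ` G"
      proof (cases "v \<in> Q")
        case True
        then have "Q = insert v (Q \<inter> S)" using Q by (auto simp: X_def)
        then show ?thesis using Q by (auto simp: X_def)
      next
        case False
        then have "Q = Q \<inter> S" using Q by (auto simp: X_def)
        then show ?thesis using Q by (auto simp: X_def)
      qed
    next
      fix Q assume "Q \<in> G \<union> insert v ` G"
      then show "Q \<in> X"
      proof
        assume Q: "Q \<in> G"
        then have "Q \<inter> S = Q" using vG by blast
        then show ?thesis using Q vG[OF Q] by (auto simp: X_def)
      next
        assume "Q \<in> insert v ` G"
        then obtain R where R: "R \<in> G" "Q = insert v R" by auto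
        then have "Q \<inter> S = R" using vG[OF R(1)] S by auto
        then show ?thesis using R vG[OF R(1)] by (auto simp: X_def)
      qed
    qed
    have inj: "inj_on (insert v) G"
      using vG(1) by (intro inj_onI) (metis insert_ident)
    have "sum wt X = sum wt G + sum wt (insert v ` G)"
      unfolding X using vG(1) by (intro sum.union_disjoint) (auto simp: fG)
    also have "sum wt G = (\<Sum>Q\<in>G. a * a ^ card (S - Q))"
    proof (intro sum.cong refl)
      fix Q assume Q: "Q \<in> G"
      have "insert v S - Q = insert v (S - Q)" using vG[OF Q] by auto
      then show "wt Q = a * a ^ card (S - Q)" using S by (simp add: wt_def)
    qed
    also have "sum wt (insert v ` G) = (\<Sum>Q\<in>G. a ^ card (S - Q))"
      unfolding sum.reindex[OF inj] o_def
    proof (intro sum.cong refl)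
      fix Q assume Q: "Q \<in> G"
      have "insert v S - insert v Q = S - Q" using S by auto
      then show "wt (insert v Q) = a ^ card (S - Q)" by (simp add: wt_def)
    qed
    finally show ?thesis
      by (simp add: avoiding_weight_def G_def sum_distrib_left sum_distrib_right sum.distrib algebra_simps)
  qed
  have sub: "avoiding \<E> (insert v S) \<subseteq> X"
    using avoiding_Int[of _ \<E> "insert v S" S] avoiding_subset[of _ \<E> "insert v S"]
    by (auto simp: X_def G_def)
  have "X - avoiding \<E> (insert v S) \<subseteq> (\<Union>e\<in>\<E>S. bad e)"
  proof
    fix Q assume "Q \<in> X - avoiding \<E> (insert v S)"
    then have Q: "Q \<subseteq> insert v S" "Q \<inter> S \<in> avoiding \<E> S" "Q \<notin> avoiding \<E> (insert v S)"
      by (auto simp: X_def G_def)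
    then obtain D B where DB: "(D, B) \<in> \<E>" "D \<subseteq> insert v S" "Q \<inter> D = B"
      by (auto simp: avoiding_def)
    have "v \<in> D"
    proof (rule ccontr)
      assume "v \<notin> D"
      then have "D \<subseteq> S" "Q \<inter> S \<inter> D = B" using DB by auto
      then show False using Q(2) DB(1) by (auto simp: avoiding_def)
    qed
    then show "Q \<in> (\<Union>e\<in>\<E>S. bad e)" using DB Q by (force simp: \<E>S_def bad_def)
  qed
  then have "sum wt (X - avoiding \<E> (insert v S)) \<le> sum wt (\<Union>e\<in>\<E>S. bad e)"
  proof (rule sum_mono2[rotated])
    show "finite (\<Union>e\<in>\<E>S. bad e)"
      by (rule finite_subset[OF _ fX]) (auto simp: bad_def X_def G_def)
  qed (use a in \<open>simp add: wt_def\<close>)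
  also have "\<dots> \<le> (\<Sum>e\<in>\<E>S. sum wt (bad e))"
  proof -
    have "finite (bad e)" for e
      by (rule finite_subset[OF _ fX]) (auto simp: bad_def X_def G_def)
    then show ?thesis using fES a
    proof (induction rule: finite_induct[OF fES])
      case 1 then show ?case by simp
    next
      case (2 e E)
      have "sum wt (\<Union>e\<in>insert e E. bad e) = sum wt (bad e \<union> (\<Union>e\<in>E. bad e))" by simp
      also have "\<dots> \<le> sum wt (bad e) + sum wt (\<Union>e\<in>E. bad e)"
      proof -
        have "sum wt (bad e \<inter> (\<Union>e\<in>E. bad e)) \<ge> 0" using a by (intro sum_nonneg) (simp add: wt_def)
        then show ?thesis using 2 by (subst sum_Un) auto
      qed
      also have "\<dots> \<le> (\<Sum>e\<in>insert e E. sum wt (bad e))" using 2 by simp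
      finally show ?case .
    qed
  qed
  also have "\<dots> \<le> (\<Sum>(D, B)\<in>\<E>S. a ^ card (D - B) * \<beta> / \<beta> ^ card D * ?w S)"
  proof (rule sum_mono, clarify)
    fix D B assume "(D, B) \<in> \<E>S"
    then have D: "v \<in> D" "D \<subseteq> insert v S" by (auto simp: \<E>S_def)
    have "sum wt (bad (D, B)) \<le> a ^ card (D - B) * ?w (S - D)"
      using avoiding_weight_violating_le[OF S D a, of \<E> B] by (simp add: bad_def wt_def)
    also have "?w (S - D) \<le> \<beta> / \<beta> ^ card D * ?w S"
    proof -
      have "S - (S - D) = D - {v}" using D S by auto
      then have "card D = Suc (card (S - (S - D)))"
        using D S by (metis card.remove finite.insertI finite_subset)
      then have "\<beta> ^ card D = \<beta> * \<beta> ^ card (S - (S - D))" by simp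
      moreover have "\<beta> ^ card (S - (S - D)) * ?w (S - D) \<le> ?w S" by (intro IH) auto
      ultimately show ?thesis using \<beta> by (simp add: field_simps)
    qed
    finally show "sum wt (bad (D, B)) \<le> a ^ card (D - B) * \<beta> / \<beta> ^ card D * ?w S"
      using a by (simp add: mult.assoc mult_left_mono)
  qed
  also have "\<dots> \<le> (\<Sum>(D, B)\<in>\<E>v. a ^ card (D - B) * \<beta> / \<beta> ^ card D * ?w S)"
    using a \<beta> w0 by (intro sum_mono2 fEv ES) auto
  also have "\<dots> = (\<Sum>(D, B)\<in>\<E>v. a ^ card (D - B) * \<beta> / \<beta> ^ card D) * ?w S"
    by (simp add: sum_distrib_right case_prod_unfold)
  also have "\<dots> \<le> (a + 1 - \<beta>) * ?w S"
    using charge w0 unfolding \<E>v_def by (intro mult_right_mono) auto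
  finally have "sum wt (X - avoiding \<E> (insert v S)) \<le> (a + 1 - \<beta>) * ?w S" .
  moreover have "sum wt (X - avoiding \<E> (insert v S)) = sum wt X - ?w (insert v S)"
    using sub fX by (simp add: sum_diff avoiding_weight_def wt_def)
  ultimately show ?thesis using sumX by (simp add: algebra_simps)
qed

text \<open>
  A form of the Local Lemma: if the total charge of the events through each point is at most
  \<open>a + 1 - \<beta>\<close>, then each new point multiplies the weight by at least \<open>\<beta>\<close>, so the weight
  stays positive.
\<close>

lemma avoiding_nonempty:
  fixes a \<beta> :: real
  assumes "finite A" "finite \<E>" and a: "a > 0" and \<beta>: "\<beta> > 0"
    and ne: "\<And>D B. (D, B) \<in> \<E> \<Longrightarrow> D \<noteq> {}"
    and charge: "\<And>v. v \<in> A \<Longrightarrow> (\<Sum>(D, B)\<in>{(D, B)\<in>\<E>. v \<in> D}. a ^ card (D - B) * \<beta> / \<beta> ^ card D) \<le> a + 1 - \<beta>"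
  shows "avoiding \<E> A \<noteq> {}"
proof -
  let ?w = "avoiding_weight a \<E>"
  have grow: "\<beta> ^ card (S - T) * ?w T \<le> ?w S" if "S \<subseteq> A" "T \<subseteq> S" for S T
    using that
  proof (induction "card S" arbitrary: S T rule: less_induct)
    case less
    show ?case
    proof (cases "T = S")
      case False
      then obtain v where v: "v \<in> S" "v \<notin> T" using less.prems by auto
      define R where "R = S - {v}"
      have R: "finite R" "v \<notin> R" "S = insert v R" "R \<subseteq> A" "T \<subseteq> R" "v \<in> A"
        using v less.prems assms(1) finite_subset by (auto simp: R_def)
      have IH: "\<beta> ^ card (R - U) * ?w U \<le> ?w R" if "U \<subseteq> R" for U
        using less.hyps[of R U] that R by simp
      have "S - T = insert v (R - T)" using R v by auto
      then have "\<beta> ^ card (S - T) * ?w T = \<beta> * (\<beta> ^ card (R - T) * ?w T)" using R by simp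
      also have "\<dots> \<le> \<beta> * ?w R" using IH[OF R(5)] \<beta> by simp
      also have "\<dots> \<le> ?w S"
        unfolding R(3) using avoiding_weight_insert[OF R(1,2) assms(2) a \<beta> charge[OF R(6)] IH] .
      finally show ?thesis .
    qed simp
  qed
  have "avoiding \<E> {} = {{}}" using ne by (force simp: avoiding_def)
  then have "?w {} = 1" by (simp add: avoiding_weight_def)
  then have "?w A > 0" using grow[of A "{}"] \<beta>
    by (metis Diff_empty empty_subsetI less_le_trans mult.right_neutral order_refl zero_less_power)
  then show ?thesis by (auto simp: avoiding_weight_def)
qed

section \<open>Sparse sets meeting every translate of a large finite set\<close>

lemma card_set_plus_le:
  fixes K Y :: "'g::group_add set"
  assumes "finite K" "finite Y"
  shows "card (K + Y) \<le> card K * card Y"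
proof -
  have "K + Y = (\<lambda>(x, y). x + y) ` (K \<times> Y)" by (auto simp: set_plus_def)
  then show ?thesis
    using card_image_le[of "K \<times> Y" "\<lambda>(x, y). x + y"] assms by (simp add: card_cartesian_product)
qed

lemma sum_le_card_times:
  fixes c :: real
  assumes "\<And>x. x \<in> S \<Longrightarrow> f x \<le> c" "card S \<le> n" "c \<ge> 0"
  shows "sum f S \<le> real n * c"
proof -
  have "sum f S \<le> real (card S) * c" using sum_bounded_above[of S f c] assms(1) by auto
  also have "\<dots> \<le> real n * c" using assms by (intro mult_right_mono) auto
  finally show ?thesis .
qed

lemma eventually_linear_times_power_le:
  fixes b d :: real
  assumes "0 < d" "d < 1"
  shows "\<exists>m0. \<forall>m\<ge>m0. real m * b * d ^ m \<le> 1 / 6"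
proof -
  have "(\<lambda>m. real m * d ^ m) \<longlonglongrightarrow> 0" using assms by (intro powser_times_n_limit_0) auto
  then have "(\<lambda>m. b * (real m * d ^ m)) \<longlonglongrightarrow> 0" by (rule tendsto_mult_right_zero)
  then have "\<forall>\<^sub>F m in sequentially. b * (real m * d ^ m) < 1 / 6"
    by (rule order_tendstoD) simp
  then obtain m0 where "\<forall>m\<ge>m0. b * (real m * d ^ m) < 1 / 6"
    by (auto simp: eventually_sequentially)
  then have "\<forall>m\<ge>m0. real m * b * d ^ m \<le> 1 / 6"
    by (metis less_imp_le mult.assoc mult.commute)
  then show ?thesis ..
qed

text \<open>
  The Local Lemma for three kinds of events: two points of \<open>Q\<close> are too close, \<open>Q\<close> misses a window, or
  \<open>Q\<close> has many points near one window. The density of \<open>Q\<close> is roughly \<open>1 / a\<close>, where \<open>a\<close> depends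
  only on \<open>card K\<close>; it must be small enough for the first and third kinds. The second and third kinds then have
  probabilities exponentially small in \<open>card E\<close>, so only a lower bound on \<open>card E\<close> is required.
\<close>

lemma separated_sparse_hitting_set:
  fixes K :: "'g::group_add set"
  assumes K: "finite K"
  shows "\<exists>m0. \<forall>E A :: 'g set. finite E \<longrightarrow> finite A \<longrightarrow> m0 \<le> card E \<longrightarrow>
           (\<exists>Q\<subseteq>A. (\<forall>q\<in>Q. \<forall>q'\<in>Q. q \<noteq> q' \<longrightarrow> q \<notin> K + {q'}) \<and>
              (\<forall>\<gamma>. card E \<le> 4 * card {f\<in>E. f + \<gamma> \<in> A} \<longrightarrow> (\<exists>f\<in>E. f + \<gamma> \<in> Q)) \<and>
              (\<forall>\<gamma>. 4 * card {f\<in>E. f + \<gamma> \<in> K + Q} < card E))"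
proof -
  define k where "k = card K + 1"
  define a :: real where "a = 2 ^ (4 * k * (k + 1))"
  define \<beta> where "\<beta> = a + 1 / 2"
  have k1: "k \<ge> 1" by (simp add: k_def)
  have a0: "a > 0" and \<beta>0: "\<beta> > 0" and a\<beta>: "a < \<beta>" "a \<le> \<beta>"
    by (auto simp: a_def \<beta>_def intro: add_pos_pos)
  define d where "d = root 4 (a / \<beta>)"
  have d: "0 < d" "d < 1" "d ^ 4 = a / \<beta>"
    using a0 \<beta>0 a\<beta> by (auto simp: d_def)
  obtain m1 where m1: "\<And>m. m \<ge> m1 \<Longrightarrow> real m * \<beta> * d ^ m \<le> 1 / 6"
    using eventually_linear_times_power_le[OF d(1,2)] by blast
  obtain m2 where m2: "\<And>m. m \<ge> m2 \<Longrightarrow> real m * (k * \<beta>) * (1 / 2) ^ m \<le> 1 / 6"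
    using eventually_linear_times_power_le[of "1 / 2"] by fastforce
  have "12 * k \<le> 2 ^ (4 * k * (k + 1))"
  proof -
    have "12 * k \<le> 16 * 2 ^ k" using less_exp[of k] by linarith
    also have "\<dots> = 2 ^ 4 * 2 ^ k" by simp
    also have "\<dots> = 2 ^ (4 + k)" by (simp add: power_add)
    also have "\<dots> \<le> 2 ^ (4 * k * (k + 1))"
    proof (rule power_increasing)
      have "4 * k * 2 \<le> 4 * k * (k + 1)" using k1 by (intro mult_le_mono) auto
      then show "4 + k \<le> 4 * k * (k + 1)" using k1 by linarith
    qed simp
    finally show ?thesis .
  qed
  then have "real (12 * k) \<le> real (2 ^ (4 * k * (k + 1)))" by (subst of_nat_le_iff)
  then have k\<beta>: "12 * real k \<le> \<beta>" using a\<beta> by (simp add: a_def)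
  show ?thesis
  proof (intro exI[of _ "max 1 (max m1 m2)"] allI impI)
    fix E A :: "'g set"
    assume fE: "finite E" and fA: "finite A" and "max 1 (max m1 m2) \<le> card E"
    then have m: "card E \<ge> 1" "card E \<ge> m1" "card E \<ge> m2" by auto
    let ?m = "card E"
    \<comment> \<open>A point of \<open>Q\<close> contributes to the intersection of \<open>E + \<gamma>\<close> and \<open>K + Q\<close> only if it lies in \<open>near \<gamma>\<close>.\<close>
    define near where "near \<gamma> = (\<lambda>(\<kappa>, f). - \<kappa> + f + \<gamma>) ` (K \<times> E)" for \<gamma>
    have near_iff: "y \<in> near \<gamma> \<longleftrightarrow> (\<exists>\<kappa>\<in>K. \<exists>f\<in>E. \<kappa> + y = f + \<gamma>)" for y \<gamma>
    proof -
      have "y = - \<kappa> + f + \<gamma> \<longleftrightarrow> \<kappa> + y = f + \<gamma>" for \<kappa> f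
        by (metis add.assoc add_minus_cancel minus_add_cancel)
      then show ?thesis by (auto simp: near_def image_iff)
    qed
    have fnear: "finite (near \<gamma>)" for \<gamma> using K fE by (simp add: near_def)
    have cnear: "card (near \<gamma>) \<le> k * ?m" for \<gamma>
    proof -
      have "card (near \<gamma>) \<le> card (K \<times> E)" unfolding near_def using K fE by (intro card_image_le) auto
      also have "\<dots> \<le> k * ?m" by (simp add: card_cartesian_product k_def)
      finally show ?thesis .
    qed
    \<comment> \<open>With \<open>\<beta> = a + 1 / 2\<close> the available charge is \<open>1 / 2\<close>; each of the three families uses at most \<open>1 / 6\<close>.\<close>
    define E1 where "E1 = {(Y, Y) | Y. Y \<subseteq> A \<and> (\<exists>q q'. Y = {q, q'} \<and> q \<noteq> q' \<and> q \<in> K + {q'})}"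
    define E2 where "E2 = {(Y, {} :: 'g set) | Y. Y \<subseteq> A \<and> (\<exists>\<gamma>. Y = {v\<in>A. v - \<gamma> \<in> E}) \<and> ?m \<le> 4 * card Y}"
    define E3 where "E3 = {(Y, Y) | Y. Y \<subseteq> A \<and> (\<exists>\<gamma>. Y \<subseteq> near \<gamma>) \<and> ?m \<le> 4 * k * card Y}"
    define \<E> where "\<E> = E1 \<union> E2 \<union> E3"
    have f\<E>: "finite \<E>"
      by (rule finite_subset[of _ "Pow A \<times> Pow A"]) (auto simp: \<E>_def E1_def E2_def E3_def fA)
    have "avoiding \<E> A \<noteq> {}"
    proof (rule avoiding_nonempty[OF fA f\<E> a0 \<beta>0])
      fix D B assume "(D, B) \<in> \<E>" then show "D \<noteq> {}"
        using m(1) by (auto simp: \<E>_def E1_def E2_def E3_def)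
    next
      fix v assume v: "v \<in> A"
      let ?c = "\<lambda>(D :: 'g set, B). a ^ card (D - B) * \<beta> / \<beta> ^ card D"
      let ?at = "\<lambda>X. {(D, B)\<in>X. v \<in> D}"
      have c0: "?c e \<ge> 0" for e using a0 \<beta>0 by (auto split: prod.split)
      have fat: "finite (?at X)" if "X \<subseteq> \<E>" for X
        using that f\<E> by (rule_tac finite_subset[of _ \<E>]) auto
      have s1: "sum ?c (?at E1) \<le> 1 / 6"
      proof -
        have "sum ?c (?at E1) \<le> real (2 * k) * (1 / \<beta>)"
        proof (rule sum_le_card_times)
          fix e assume "e \<in> ?at E1"
          then show "?c e \<le> 1 / \<beta>" using \<beta>0 by (auto simp: E1_def power2_eq_square)
        next
          let ?N = "(\<lambda>\<kappa>. ({v, - \<kappa> + v}, {v, - \<kappa> + v})) ` K \<union> (\<lambda>\<kappa>. ({v, \<kappa> + v}, {v, \<kappa> + v})) ` K"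
          have "?at E1 \<subseteq> ?N"
          proof
            fix e assume "e \<in> ?at E1"
            then obtain q q' where q: "e = ({q, q'}, {q, q'})" "q \<in> K + {q'}" "v = q \<or> v = q'"
              by (auto simp: E1_def)
            then obtain \<kappa> where \<kappa>: "\<kappa> \<in> K" "q = \<kappa> + q'" by (auto elim!: set_plus_elim)
            then have "q' = - \<kappa> + q" by simp
            then have "e = ({v, - \<kappa> + v}, {v, - \<kappa> + v}) \<or> e = ({v, \<kappa> + v}, {v, \<kappa> + v})"
              using q \<kappa>(2) by (metis insert_commute)
            then show "e \<in> ?N" using \<kappa>(1) by blast
          qed
          then have "card (?at E1) \<le> card ?N" using K by (intro card_mono) auto
          also have "\<dots> \<le> card K + card K"
            by (intro order_trans[OF card_Un_le] add_mono card_image_le K)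
          finally show "card (?at E1) \<le> 2 * k" by (simp add: k_def)
        qed (use \<beta>0 in simp)
        also have "real (2 * k) * (1 / \<beta>) \<le> 1 / 6" using k\<beta> \<beta>0 by (simp add: field_simps)
        finally show ?thesis .
      qed
      have s2: "sum ?c (?at E2) \<le> 1 / 6"
      proof -
        have "sum ?c (?at E2) \<le> real ?m * (\<beta> * d ^ ?m)"
        proof (rule sum_le_card_times)
          fix e assume "e \<in> ?at E2"
          then obtain Y where Y: "e = (Y, {})" "?m \<le> 4 * card Y" by (auto simp: E2_def)
          have "?c e = \<beta> * (a / \<beta>) ^ card Y" using Y by (simp add: power_divide)
          also have "(a / \<beta>) ^ card Y = d ^ (4 * card Y)" by (simp add: d(3) power_mult)
          also have "\<dots> \<le> d ^ ?m" using d Y by (intro power_decreasing) auto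
          finally show "?c e \<le> \<beta> * d ^ ?m" using \<beta>0 by simp
        next
          have "?at E2 \<subseteq> (\<lambda>f. ({u\<in>A. u - (- f + v) \<in> E}, {})) ` E"
          proof
            fix e assume "e \<in> ?at E2"
            then obtain \<gamma> where g: "e = ({u\<in>A. u - \<gamma> \<in> E}, {})" "v - \<gamma> \<in> E" by (auto simp: E2_def)
            have "- (v - \<gamma>) + v = \<gamma>" by simp
            then show "e \<in> (\<lambda>f. ({u\<in>A. u - (- f + v) \<in> E}, {})) ` E" using g by (intro image_eqI[of _ _ "v - \<gamma>"]) simp_all
          qed
          then show "card (?at E2) \<le> ?m" using fE by (meson card_image_le card_mono finite_imageI order_trans)
        qed (use \<beta>0 d in simp)
        also have "\<dots> \<le> 1 / 6" using m1[OF m(2)] by (simp add: mult.assoc)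
        finally show ?thesis .
      qed
      have s3: "sum ?c (?at E3) \<le> 1 / 6"
      proof -
        have "sum ?c (?at E3) \<le> real (k * ?m * 2 ^ (k * ?m)) * (\<beta> / 2 ^ ((k + 1) * ?m))"
        proof (rule sum_le_card_times)
          fix e assume "e \<in> ?at E3"
          then obtain Y where Y: "e = (Y, Y)" "?m \<le> 4 * k * card Y" by (auto simp: E3_def)
          \<comment> \<open>The exponent in \<open>a\<close> is chosen so that the charge of one event beats the \<open>2 ^ (k * ?m)\<close> subsets of \<open>near \<gamma>\<close>.\<close>
          have "(2::real) ^ ((k + 1) * ?m) \<le> 2 ^ ((k + 1) * (4 * k * card Y))"
            using Y by (intro power_increasing mult_left_mono) auto
          also have "\<dots> = a ^ card Y" by (simp add: a_def power_mult[symmetric] mult_ac)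
          also have "\<dots> \<le> \<beta> ^ card Y" using a0 a\<beta> by (intro power_mono) auto
          finally show "?c e \<le> \<beta> / 2 ^ ((k + 1) * ?m)" using \<beta>0 Y by (simp add: frac_le)
        next
          let ?N = "\<Union>(\<kappa>, f)\<in>K \<times> E. (\<lambda>Y. (Y, Y)) ` Pow (near (- f + \<kappa> + v))"
          have "?at E3 \<subseteq> ?N"
          proof
            fix e assume "e \<in> ?at E3"
            then obtain Y \<gamma> where Y: "e = (Y, Y)" "Y \<subseteq> near \<gamma>" "v \<in> Y" by (auto simp: E3_def)
            then obtain \<kappa> f where kf: "\<kappa> \<in> K" "f \<in> E" "\<kappa> + v = f + \<gamma>" using near_iff by blast
            then have "\<gamma> = - f + \<kappa> + v" by (metis add.assoc minus_add_cancel)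
            then show "e \<in> ?N" using Y kf by auto
          qed
          then have "card (?at E3) \<le> card ?N"
            using K fE fnear by (intro card_mono) auto
          also have "\<dots> \<le> (\<Sum>(\<kappa>, f)\<in>K \<times> E. card ((\<lambda>Y. (Y, Y)) ` Pow (near (- f + \<kappa> + v))))"
            using K fE by (intro order_trans[OF card_UN_le]) (auto simp: case_prod_unfold)
          also have "\<dots> \<le> card (K \<times> E) * 2 ^ (k * ?m)"
          proof -
            have "card ((\<lambda>Y. (Y, Y)) ` Pow (near \<gamma>)) \<le> 2 ^ (k * ?m)" for \<gamma>
            proof -
              have "card ((\<lambda>Y. (Y, Y)) ` Pow (near \<gamma>)) \<le> card (Pow (near \<gamma>))"
                using fnear by (intro card_image_le) auto
              also have "\<dots> \<le> 2 ^ (k * ?m)" using cnear[of \<gamma>] by (simp add: card_Pow fnear power_increasing)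
              finally show ?thesis .
            qed
            then show ?thesis
              by (intro order_trans[OF sum_bounded_above[of _ _ "2 ^ (k * ?m)"]]) auto
          qed
          also have "\<dots> \<le> k * ?m * 2 ^ (k * ?m)"
            by (simp add: card_cartesian_product k_def)
          finally show "card (?at E3) \<le> k * ?m * 2 ^ (k * ?m)" .
        qed (use \<beta>0 in simp)
        also have "\<dots> = real ?m * (k * \<beta>) * (1 / 2) ^ ?m"
          by (simp add: power_add power_divide field_simps)
        also have "\<dots> \<le> 1 / 6" using m2[OF m(3)] .
        finally show ?thesis .
      qed
      have "?at \<E> = ?at E1 \<union> (?at E2 \<union> ?at E3)" by (auto simp: \<E>_def)
      then have "sum ?c (?at \<E>) \<le> sum ?c (?at E1) + (sum ?c (?at E2) + sum ?c (?at E3))"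
      proof -
        have un: "sum ?c (X \<union> Y) \<le> sum ?c X + sum ?c Y" if "finite X" "finite Y" for X Y
          using that sum_nonneg[of "X \<inter> Y" ?c] c0 by (subst sum_Un) auto
        have f: "finite (?at E1)" "finite (?at E2)" "finite (?at E3)" by (intro fat, force simp: \<E>_def)+
        show ?thesis unfolding \<open>?at \<E> = _\<close>
          using un[of "?at E1" "?at E2 \<union> ?at E3"] un[of "?at E2" "?at E3"] f by force
      qed
      also have "\<dots> \<le> 1 / 2" using s1 s2 s3 by simp
      finally show "sum ?c (?at \<E>) \<le> a + 1 - \<beta>" by (simp add: \<beta>_def)
    qed
    then obtain Q where "Q \<in> avoiding \<E> A" by blast
    then have QA: "Q \<subseteq> A" and Q: "\<And>D B. (D, B) \<in> \<E> \<Longrightarrow> D \<subseteq> A \<Longrightarrow> Q \<inter> D \<noteq> B"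
      by (auto simp: avoiding_def)
    show "\<exists>Q\<subseteq>A. (\<forall>q\<in>Q. \<forall>q'\<in>Q. q \<noteq> q' \<longrightarrow> q \<notin> K + {q'}) \<and>
              (\<forall>\<gamma>. ?m \<le> 4 * card {f\<in>E. f + \<gamma> \<in> A} \<longrightarrow> (\<exists>f\<in>E. f + \<gamma> \<in> Q)) \<and>
              (\<forall>\<gamma>. 4 * card {f\<in>E. f + \<gamma> \<in> K + Q} < ?m)"
    proof (intro exI[of _ Q] conjI QA ballI allI impI)
      fix q q' assume q: "q \<in> Q" "q' \<in> Q" "q \<noteq> q'"
      show "q \<notin> K + {q'}"
      proof
        assume "q \<in> K + {q'}"
        then have "({q, q'}, {q, q'}) \<in> \<E>" using q QA by (auto simp: \<E>_def E1_def)
        then show False using Q[of "{q, q'}" "{q, q'}"] q QA by auto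
      qed
    next
      fix \<gamma> assume h: "?m \<le> 4 * card {f\<in>E. f + \<gamma> \<in> A}"
      define Y where "Y = {v\<in>A. v - \<gamma> \<in> E}"
      have "Y = (\<lambda>f. f + \<gamma>) ` {f\<in>E. f + \<gamma> \<in> A}"
        by (force simp: Y_def image_iff)
      then have "card Y = card {f\<in>E. f + \<gamma> \<in> A}" by (simp add: card_image inj_on_def)
      then have "(Y, {}) \<in> \<E>" using h by (auto simp: \<E>_def E2_def Y_def)
      then have "Q \<inter> Y \<noteq> {}" using Q[of Y "{}"] by (auto simp: Y_def)
      then obtain v where "v \<in> Q" "v - \<gamma> \<in> E" by (auto simp: Y_def)
      then show "\<exists>f\<in>E. f + \<gamma> \<in> Q" by (intro bexI[of _ "v - \<gamma>"]) auto
    next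
      fix \<gamma>
      show "4 * card {f\<in>E. f + \<gamma> \<in> K + Q} < ?m"
      proof (rule ccontr)
        assume h: "\<not> 4 * card {f\<in>E. f + \<gamma> \<in> K + Q} < ?m"
        define Y where "Y = Q \<inter> near \<gamma>"
        have fY: "finite Y" using fnear by (simp add: Y_def)
        have "(\<lambda>f. f + \<gamma>) ` {f\<in>E. f + \<gamma> \<in> K + Q} \<subseteq> K + Y"
        proof (clarsimp elim!: set_plus_elim)
          fix f \<kappa> q assume "f \<in> E" "f + \<gamma> = \<kappa> + q" "\<kappa> \<in> K" "q \<in> Q"
          moreover from this have "q \<in> near \<gamma>" using near_iff by metis
          ultimately show "\<kappa> + q \<in> K + Y" by (auto simp: Y_def)
        qed
        then have "card {f\<in>E. f + \<gamma> \<in> K + Q} \<le> card (K + Y)"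
          using finite_set_plus[OF K fY] by (intro card_inj_on_le[of "\<lambda>f. f + \<gamma>"]) (auto simp: inj_on_def)
        also have "\<dots> \<le> k * card Y"
          using card_set_plus_le[OF K fY] by (simp add: k_def)
        finally have "?m \<le> 4 * k * card Y" using h by simp
        then have "(Y, Y) \<in> \<E>" using QA by (auto simp: \<E>_def E3_def Y_def)
        then show False using Q[of Y Y] QA by (auto simp: Y_def)
      qed
    qed
  qed
qed

section \<open>Finite patterns recurring in prescribed windows\<close>

type_synonym 'g pattern = "'g \<rightharpoonup> bool"

text \<open>
  With \<open>x\<close> read as a total pattern, \<open>shift g x\<close> extends \<open>s\<close> exactly when \<open>x\<close> extends \<open>place s g\<close>.
\<close>

definition place :: "'g::group_add pattern \<Rightarrow> 'g \<Rightarrow> 'g pattern" where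
  "place s g = (\<lambda>h. s (h - g))"

lemma dom_place: "dom (place s g) = dom s + {g}"
  by (force simp: place_def set_plus_def dom_def)

lemma in_dom_placeE:
  assumes "y \<in> dom (place s q)"
  obtains d where "d \<in> dom s" "y = d + q"
proof -
  have "y \<in> dom s + {q}" using assms by (simp only: dom_place)
  then show ?thesis by (elim set_plus_elim) (use that in simp)
qed

lemma place_place: "place (place s g) h = place s (g + h)"
  by (simp add: place_def diff_add_eq_diff_diff_swap)

lemma place_mono: "s \<subseteq>\<^sub>m p \<Longrightarrow> place s g \<subseteq>\<^sub>m place p g"
  by (auto simp: map_le_def place_def dom_def)

text \<open>
  A triple \<open>(E, C, s)\<close> stands for the demand that every window \<open>E + \<gamma>\<close> contains a position at which the
  pattern \<open>s\<close> occurs. The set \<open>C\<close> is a margin: a copy of \<open>s\<close> at a position outside \<open>C + P\<close> does not interfere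
  with a pattern whose domain is \<open>P\<close>.
\<close>

type_synonym 'g demand = "'g set \<times> 'g set \<times> 'g pattern"

definition occurs :: "'g::group_add set \<Rightarrow> 'g pattern \<Rightarrow> 'g pattern \<Rightarrow> 'g \<Rightarrow> bool" where
  "occurs E s p \<gamma> \<longleftrightarrow> (\<exists>f\<in>E. place s (f + \<gamma>) \<subseteq>\<^sub>m p)"

text \<open>
  The demand is required of a partial pattern \<open>p\<close> only for windows of which at least the fraction
  \<open>t / 4\<close> is too close to the domain of \<open>p\<close> to be available for new copies. All other windows can
  still be served outside \<open>p\<close>. Patterns handed on from one stage to the next satisfy this
  with \<open>t = 2\<close>; the slack up to \<open>t = 3\<close> is consumed when a few points are added.
\<close>

definition saturated :: "nat \<Rightarrow> 'g::group_add demand \<Rightarrow> 'g pattern \<Rightarrow> bool" where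
  "saturated t = (\<lambda>(E, C, s) p.
     \<forall>\<gamma>. t * card E \<le> 4 * card {f\<in>E. f + \<gamma> \<in> C + dom p} \<longrightarrow> occurs E s p \<gamma>)"

lemma saturatedD:
  "saturated t (E, C, s) p \<Longrightarrow> t * card E \<le> 4 * card {f\<in>E. f + \<gamma> \<in> C + dom p} \<Longrightarrow> occurs E s p \<gamma>"
  by (auto simp: saturated_def)

lemma saturated_mono: "saturated t \<xi> p \<Longrightarrow> t \<le> t' \<Longrightarrow> saturated t' \<xi> p"
  unfolding saturated_def by (auto split: prod.splits) (meson mult_le_mono1 order_trans)

lemma occurs_mono: "occurs E s p \<gamma> \<Longrightarrow> p \<subseteq>\<^sub>m q \<Longrightarrow> occurs E s q \<gamma>"
  unfolding occurs_def by (meson map_le_trans)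

lemma saturated_place:
  assumes "saturated t \<xi> p"
  shows "saturated t \<xi> (place p g)"
proof -
  obtain E C s where [simp]: "\<xi> = (E, C, s)" by (cases \<xi>)
  have "occurs E s (place p g) \<gamma>"
    if h: "t * card E \<le> 4 * card {f\<in>E. f + \<gamma> \<in> C + dom (place p g)}" for \<gamma>
  proof -
    have "f + \<gamma> \<in> C + dom (place p g) \<longleftrightarrow> f + (\<gamma> - g) \<in> C + dom p" for f
    proof -
      have "f + \<gamma> \<in> C + dom (place p g) \<longleftrightarrow> (\<exists>c\<in>C. \<exists>d\<in>dom p. f + \<gamma> = c + d + g)"
        by (force simp: dom_place set_plus_def add.assoc)
      also have "\<dots> \<longleftrightarrow> (\<exists>c\<in>C. \<exists>d\<in>dom p. f + \<gamma> - g = c + d)"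
        by (simp add: diff_eq_eq)
      also have "\<dots> \<longleftrightarrow> f + (\<gamma> - g) \<in> C + dom p"
        by (auto simp: set_plus_def add_diff_eq)
      finally show ?thesis .
    qed
    then have "occurs E s p (\<gamma> - g)" using h assms by (intro saturatedD[of t E C]) auto
    then obtain f where f: "f \<in> E" "place s (f + (\<gamma> - g)) \<subseteq>\<^sub>m p" by (auto simp: occurs_def)
    have "place s (f + \<gamma>) = place (place s (f + (\<gamma> - g))) g"
      by (simp add: place_place add.assoc)
    then show ?thesis using f place_mono unfolding occurs_def by metis
  qed
  then show ?thesis by (simp add: saturated_def)
qed

lemma disjoint_patterns_union:
  assumes "\<And>p p'. p \<in> \<F> \<Longrightarrow> p' \<in> \<F> \<Longrightarrow> p \<noteq> p' \<Longrightarrow> dom p \<inter> dom p' = {}"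
  shows "\<exists>u. dom u = (\<Union>p\<in>\<F>. dom p) \<and> (\<forall>p\<in>\<F>. p \<subseteq>\<^sub>m u)"
proof -
  define u where "u h = (if h \<in> (\<Union>p\<in>\<F>. dom p) then (SOME p. p \<in> \<F> \<and> h \<in> dom p) h else None)" for h
  have eq: "u h = p h" if "p \<in> \<F>" "h \<in> dom p" for p h
  proof -
    have "(SOME p. p \<in> \<F> \<and> h \<in> dom p) = p"
    proof (rule some_equality)
      show "p' = p" if "p' \<in> \<F> \<and> h \<in> dom p'" for p'
        using that assms[of p' p] \<open>p \<in> \<F>\<close> \<open>h \<in> dom p\<close> by blast
    qed (use that in blast)
    moreover have "h \<in> (\<Union>p\<in>\<F>. dom p)" using that by blast
    ultimately show ?thesis unfolding u_def by metis
  qed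
  have le: "p \<subseteq>\<^sub>m u" if "p \<in> \<F>" for p using eq[OF that] by (auto simp: map_le_def)
  have "dom u = (\<Union>p\<in>\<F>. dom p)"
  proof (intro equalityI subsetI)
    fix h assume "h \<in> dom u"
    show "h \<in> (\<Union>p\<in>\<F>. dom p)"
    proof (rule ccontr)
      assume "h \<notin> (\<Union>p\<in>\<F>. dom p)"
      then have "u h = None" unfolding u_def by (rule if_not_P)
      then show False using \<open>h \<in> dom u\<close> by (simp add: domIff)
    qed
  next
    fix h assume "h \<in> (\<Union>p\<in>\<F>. dom p)"
    then obtain p where "p \<in> \<F>" "h \<in> dom p" by blast
    then show "h \<in> dom u" using eq[of p h] by (simp add: domIff)
  qed
  then show ?thesis using le by blast
qed

text \<open>
  If one window \<open>E + \<gamma>\<close> comes within the margin \<open>C\<close> of two points, then they differ by an element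
  of this set.
\<close>

definition interaction :: "'g::group_add demand \<Rightarrow> 'g set" where
  "interaction = (\<lambda>(E, C, s). uminus ` C + (E + (uminus ` E + C)))"

lemma finite_interaction: "finite E \<Longrightarrow> finite C \<Longrightarrow> finite (interaction (E, C, s))"
  by (simp add: interaction_def finite_set_plus)

lemma uminus_interaction: "n \<in> interaction \<xi> \<Longrightarrow> - n \<in> interaction \<xi>"
proof (cases \<xi>)
  case (fields E C s)
  assume "n \<in> interaction \<xi>"
  then obtain c e e' c' where "c \<in> C" "e \<in> E" "e' \<in> E" "c' \<in> C" "n = - c + (e + (- e' + c'))"
    by (auto simp: fields interaction_def elim!: set_plus_elim)
  moreover from this have "- n = - c' + (e' + (- e + c))"
    by (simp only: minus_add minus_minus add.assoc)
  ultimately show ?thesis by (auto simp: fields interaction_def intro!: set_plus_intro)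
qed

lemma interaction_separates:
  assumes "f \<in> E" "f' \<in> E" "f + \<gamma> \<in> C + X" "f' + \<gamma> \<in> C + Y"
  shows "\<exists>x\<in>X. \<exists>y\<in>Y. \<exists>n\<in>interaction (E, C, s). x = n + y"
proof -
  obtain c x where x: "c \<in> C" "x \<in> X" "f + \<gamma> = c + x" using assms(3) by (auto elim!: set_plus_elim)
  obtain c' y where y: "c' \<in> C" "y \<in> Y" "f' + \<gamma> = c' + y" using assms(4) by (auto elim!: set_plus_elim)
  have "\<gamma> = - f' + (c' + y)" using y(3) by (metis minus_add_cancel)
  then have "x = - c + (f + (- f' + (c' + y)))" using x(3) by (metis minus_add_cancel)
  then have "x = (- c + (f + (- f' + c'))) + y" by (simp add: add.assoc)
  moreover have "- c + (f + (- f' + c')) \<in> interaction (E, C, s)"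
    using assms(1,2) x y by (auto simp: interaction_def intro!: set_plus_intro)
  ultimately show ?thesis using x y by blast
qed

text \<open>
  When the pieces are far apart relative to \<open>E\<close>, a window close to the union is close to a single piece, and that
  piece already contains the required copy. Thus the union is saturated with the same threshold, however
  many pieces there are.
\<close>

lemma saturated_union:
  assumes E: "0 < card E" "0 < t"
    and saturated: "\<And>p. p \<in> \<F> \<Longrightarrow> saturated t (E, C, s) p"
    and u: "dom u = (\<Union>p\<in>\<F>. dom p)" "\<And>p. p \<in> \<F> \<Longrightarrow> p \<subseteq>\<^sub>m u"
    and sep: "\<And>p p' x y n. p \<in> \<F> \<Longrightarrow> p' \<in> \<F> \<Longrightarrow> p \<noteq> p' \<Longrightarrow> x \<in> dom p \<Longrightarrow> y \<in> dom p' \<Longrightarrow>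
                n \<in> interaction (E, C, s) \<Longrightarrow> x \<noteq> n + y"
  shows "saturated t (E, C, s) u"
proof -
  have "occurs E s u \<gamma>" if h: "t * card E \<le> 4 * card {f\<in>E. f + \<gamma> \<in> C + dom u}" for \<gamma>
  proof -
    have "{f\<in>E. f + \<gamma> \<in> C + dom u} \<noteq> {}" using h E by (metis card.empty le_zero_eq mult_0_right mult_eq_0_iff neq0_conv)
    then obtain f0 where f0: "f0 \<in> E" "f0 + \<gamma> \<in> C + dom u" by blast
    then obtain p where p: "p \<in> \<F>" "f0 + \<gamma> \<in> C + dom p" by (auto simp: u(1) set_plus_def)
    have "{f\<in>E. f + \<gamma> \<in> C + dom u} \<subseteq> {f\<in>E. f + \<gamma> \<in> C + dom p}"
    proof clarify
      fix f assume f: "f \<in> E" "f + \<gamma> \<in> C + dom u"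
      then obtain p' where p': "p' \<in> \<F>" "f + \<gamma> \<in> C + dom p'" by (auto simp: u(1) set_plus_def)
      have "p' = p"
        using interaction_separates[OF f(1) f0(1) p'(2) p(2), of s] sep[OF p'(1) p(1)] by blast
      then show "f + \<gamma> \<in> C + dom p" using p' by simp
    qed
    then have "card {f\<in>E. f + \<gamma> \<in> C + dom u} \<le> card {f\<in>E. f + \<gamma> \<in> C + dom p}"
      using card_ge_0_finite[OF E(1)] by (intro card_mono) auto
    then have "occurs E s p \<gamma>" using h by (intro saturatedD[OF saturated[OF p(1)]]) simp
    then show ?thesis using u(2)[OF p(1)] by (rule occurs_mono)
  qed
  then show ?thesis by (simp add: saturated_def)
qed

text \<open>
  Saturation with the weaker threshold \<open>3\<close> can be improved to \<open>2\<close> by adding points within a bounded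
  distance \<open>L\<close>. The bound does not depend on the pattern \<open>p\<close>, so that a later demand can be chosen to
  tolerate the growth caused by the earlier ones.
\<close>

definition extendable :: "'g::group_add demand set \<Rightarrow> bool" where
  "extendable \<Lambda> \<longleftrightarrow> (\<exists>L. finite L \<and>
     (\<forall>p. finite (dom p) \<longrightarrow> (\<forall>\<xi>\<in>\<Lambda>. saturated 3 \<xi> p) \<longrightarrow>
       (\<exists>q. p \<subseteq>\<^sub>m q \<and> finite (dom q) \<and> dom q \<subseteq> L + dom p \<and> (\<forall>\<xi>\<in>\<Lambda>. saturated 2 \<xi> q))))"

lemma extendable_empty: "extendable {}"
proof -
  have "\<exists>q. p \<subseteq>\<^sub>m q \<and> finite (dom q) \<and> dom q \<subseteq> {0} + dom p" if "finite (dom p)" for p :: "'a pattern"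
    using that by (intro exI[of _ p]) (auto simp: set_plus_def)
  then show ?thesis unfolding extendable_def by (intro exI[of _ "{0}"]) simp
qed

lemma set_plus_mono_left: "x \<in> A + B \<Longrightarrow> A \<subseteq> A' \<Longrightarrow> x \<in> A' + (B :: 'g::group_add set)"
  by (auto simp: set_plus_def)

text \<open>
  The new demand is met first: copies of \<open>s\<close> are placed at a sparse set \<open>Q\<close> of positions around \<open>p\<close>, outside
  the margin \<open>C + dom p\<close>. The copies and \<open>p\<close> are so far apart that the union inherits the older
  demands, and extendability for those produces \<open>q\<close> inside \<open>L + dom u\<close>. A window half of which is close to
  \<open>q\<close> contains a copy for one of the following reasons. The growth around \<open>Q\<close> accounts for less than a quarter of it, so a quarter
  is close to the growth around \<open>p\<close>. If the window does not touch the margin of \<open>p\<close>, this quarter was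
  available to \<open>Q\<close>. If it touches the margin, then either three quarters of it lie in the margin
  and \<open>p\<close> itself contains a copy, or more than a quarter of it was available to \<open>Q\<close>.
\<close>

lemma extendable_insert:
  fixes \<Lambda> :: "'g::group_add demand set"
  assumes \<Lambda>: "finite \<Lambda>" "\<And>E C r. (E, C, r) \<in> \<Lambda> \<Longrightarrow> finite E \<and> E \<noteq> {} \<and> finite C"
    and ext: "extendable \<Lambda>"
    and s: "finite (dom s)" "\<And>\<xi>. \<xi> \<in> \<Lambda> \<Longrightarrow> saturated 3 \<xi> s"
  shows "\<exists>C m0. finite C \<and> 0 \<in> C \<and>
           (\<forall>E. finite E \<longrightarrow> m0 \<le> card E \<longrightarrow> extendable (insert (E, C, s) \<Lambda>))"
proof -
  obtain L where L: "finite L" and extL: "\<forall>p. finite (dom p) \<longrightarrow> (\<forall>\<xi>\<in>\<Lambda>. saturated 3 \<xi> p) \<longrightarrow>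
       (\<exists>q. p \<subseteq>\<^sub>m q \<and> finite (dom q) \<and> dom q \<subseteq> L + dom p \<and> (\<forall>\<xi>\<in>\<Lambda>. saturated 2 \<xi> q))"
    using ext unfolding extendable_def by (elim exE conjE)
  define N where "N = insert 0 (\<Union>\<xi>\<in>\<Lambda>. interaction \<xi>)"
  have N0: "0 \<in> N" by (simp add: N_def)
  have Nreach: "n \<in> N" if "\<xi> \<in> \<Lambda>" "n \<in> interaction \<xi>" for \<xi> n using that by (auto simp: N_def)
  have Nminus: "- n \<in> N" if "n \<in> N" for n using that uminus_interaction by (fastforce simp: N_def)
  have "finite (interaction \<xi>)" if "\<xi> \<in> \<Lambda>" for \<xi>
    using that \<Lambda>(2) by (cases \<xi>) (simp add: finite_interaction)
  then have fN: "finite N" using \<Lambda>(1) by (simp add: N_def)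
  define C where "C = insert 0 (uminus ` dom s + N)"
  define K where "K = (uminus ` dom s + (N + dom s)) \<union> (C + (L + dom s))"
  have fC: "finite C" and fK: "finite K" using fN s(1) L by (simp_all add: C_def K_def finite_set_plus)
  have avoidC: "x + q \<noteq> n + y" if "q \<notin> C + P" "x \<in> dom s" "n \<in> N" "y \<in> P" for q x n y P
  proof
    assume "x + q = n + y"
    then have "q = (- x + n) + y" by (metis add.assoc minus_add_cancel)
    moreover have "- x + n \<in> C" using that by (auto simp: C_def intro!: set_plus_intro)
    ultimately show False using that by (auto intro!: set_plus_intro)
  qed
  have avoidK: "x + q \<noteq> n + (y + q')" if "q \<notin> K + {q'}" "x \<in> dom s" "n \<in> N" "y \<in> dom s" for q q' x n y
  proof
    assume "x + q = n + (y + q')"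
    then have "q = (- x + (n + y)) + q'" by (metis add.assoc minus_add_cancel)
    moreover have "- x + (n + y) \<in> K" using that by (auto simp: K_def intro!: set_plus_intro)
    ultimately show False using that by (auto intro!: set_plus_intro)
  qed
  obtain m0 where m0: "\<forall>E A :: 'g set. finite E \<longrightarrow> finite A \<longrightarrow> m0 \<le> card E \<longrightarrow>
           (\<exists>Q\<subseteq>A. (\<forall>q\<in>Q. \<forall>q'\<in>Q. q \<noteq> q' \<longrightarrow> q \<notin> K + {q'}) \<and>
              (\<forall>\<gamma>. card E \<le> 4 * card {f\<in>E. f + \<gamma> \<in> A} \<longrightarrow> (\<exists>f\<in>E. f + \<gamma> \<in> Q)) \<and>
              (\<forall>\<gamma>. 4 * card {f\<in>E. f + \<gamma> \<in> K + Q} < card E))"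
    using separated_sparse_hitting_set[OF fK] by (elim exE)
  have "extendable (insert (E, C, s) \<Lambda>)" if E: "finite E" "m0 \<le> card E" for E
  proof -
    \<comment> \<open>Candidate positions: those affected by the growth around \<open>p\<close>, and all of every window that touches the margin of \<open>p\<close>.\<close>
    define H where "H = (C + L) \<union> (E + (uminus ` E + C))"
    have fH: "finite H" using E fC L by (auto simp: H_def finite_set_plus)
    define L' where "L' = L + (insert 0 (dom s + H))"
    have "\<exists>q. p \<subseteq>\<^sub>m q \<and> finite (dom q) \<and> dom q \<subseteq> L' + dom p \<and> (\<forall>\<xi>\<in>insert (E, C, s) \<Lambda>. saturated 2 \<xi> q)"
      if p: "finite (dom p)" and gp: "\<forall>\<xi>\<in>insert (E, C, s) \<Lambda>. saturated 3 \<xi> p" for p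
    proof -
      let ?P = "dom p"
      define A where "A = (H + ?P) - (C + ?P)"
      have fA: "finite A" using fH p by (simp add: A_def finite_set_plus)
      obtain Q where QA: "Q \<subseteq> A"
        and Q1: "\<forall>q\<in>Q. \<forall>q'\<in>Q. q \<noteq> q' \<longrightarrow> q \<notin> K + {q'}"
        and Q2: "\<forall>\<gamma>. card E \<le> 4 * card {f\<in>E. f + \<gamma> \<in> A} \<longrightarrow> (\<exists>f\<in>E. f + \<gamma> \<in> Q)"
        and Q3: "\<forall>\<gamma>. 4 * card {f\<in>E. f + \<gamma> \<in> K + Q} < card E"
        using m0[THEN spec, THEN spec, THEN mp, THEN mp, THEN mp, OF E(1) fA E(2)] by (elim exE conjE)
      note Qsep = Q1[rule_format] and Qhit = Q2[rule_format] and Qsparse = Q3[rule_format]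
      have fQ: "finite Q" using QA fA finite_subset by blast
      define \<F> where "\<F> = insert p (place s ` Q)"
      have sep: "x \<noteq> n + y" if p': "p' \<in> \<F>" "p'' \<in> \<F>" "p' \<noteq> p''" "x \<in> dom p'" "y \<in> dom p''" "n \<in> N"
        for p' p'' x y n
      proof -
        consider "p' = p" "p'' \<in> place s ` Q" | "p'' = p" "p' \<in> place s ` Q"
          | "p' \<in> place s ` Q" "p'' \<in> place s ` Q"
          using p' by (auto simp: \<F>_def)
        then show ?thesis
        proof cases
          case 1
          then obtain q where q: "q \<in> Q" "p'' = place s q" by blast
          obtain d where d: "d \<in> dom s" "y = d + q" using p'(5) unfolding q(2) by (rule in_dom_placeE)
          have "q \<notin> C + ?P" using q QA by (auto simp: A_def)
          then have "y \<noteq> - n + x" using avoidC[of q ?P d "- n" x] Nminus p'(4,6) d 1(1) by simp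
          then show ?thesis by (metis minus_add_cancel)
        next
          case 2
          then obtain q where q: "q \<in> Q" "p' = place s q" by blast
          obtain d where d: "d \<in> dom s" "x = d + q" using p'(4) unfolding q(2) by (rule in_dom_placeE)
          have "q \<notin> C + ?P" using q QA by (auto simp: A_def)
          then show ?thesis using avoidC[of q ?P d n y] p'(5,6) d 2(1) by simp
        next
          case 3
          then obtain q q' where q: "q \<in> Q" "q' \<in> Q" "p' = place s q" "p'' = place s q'" by blast
          obtain d where d: "d \<in> dom s" "x = d + q" using p'(4) unfolding q(3) by (rule in_dom_placeE)
          obtain d' where d': "d' \<in> dom s" "y = d' + q'" using p'(5) unfolding q(4) by (rule in_dom_placeE)
          have "q \<noteq> q'" using q p'(3) by blast
          then show ?thesis using avoidK[OF Qsep[OF q(1,2)], of d n d'] p'(6) d d' by simp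
        qed
      qed
      have "\<exists>u. dom u = (\<Union>r\<in>\<F>. dom r) \<and> (\<forall>r\<in>\<F>. r \<subseteq>\<^sub>m u)"
      proof (rule disjoint_patterns_union)
        fix p' p'' assume pp: "p' \<in> \<F>" "p'' \<in> \<F>" "p' \<noteq> p''"
        have "x \<noteq> y" if "x \<in> dom p'" "y \<in> dom p''" for x y
          using sep[OF pp that N0] by simp
        then show "dom p' \<inter> dom p'' = {}" by blast
      qed
      then obtain u where u: "dom u = (\<Union>r\<in>\<F>. dom r)" and ule: "\<forall>r\<in>\<F>. r \<subseteq>\<^sub>m u" by (elim exE conjE)
      have "(\<Union>q\<in>Q. dom s + {q}) = dom s + Q" by (auto simp: set_plus_def)
      then have domu: "dom u = ?P \<union> (dom s + Q)" by (simp add: u \<F>_def dom_place)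
      have fu: "finite (dom u)" using p s fQ by (simp add: domu finite_set_plus)
      have gu: "saturated 3 \<xi> u" if \<xi>: "\<xi> \<in> \<Lambda>" for \<xi>
      proof -
        obtain E' C' r where [simp]: "\<xi> = (E', C', r)" by (cases \<xi>)
        show ?thesis unfolding \<open>\<xi> = _\<close>
        proof (rule saturated_union[OF _ _ _ u ule[rule_format]])
          show "0 < card E'" using \<Lambda>(2) \<xi> by (auto simp: card_gt_0_iff)
          show "saturated 3 (E', C', r) p'" if "p' \<in> \<F>" for p'
            using that gp \<xi> saturated_place[OF s(2)[OF \<xi>]] by (auto simp: \<F>_def)
          show "x \<noteq> n + y" if "p' \<in> \<F>" "p'' \<in> \<F>" "p' \<noteq> p''" "x \<in> dom p'" "y \<in> dom p''" "n \<in> interaction (E', C', r)"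
            for p' p'' x y n
            using sep[OF that(1-5)] Nreach[OF \<xi>, of n] that(6) by simp
        qed simp_all
      qed
      obtain q where q: "u \<subseteq>\<^sub>m q" "finite (dom q)" "dom q \<subseteq> L + dom u" "\<forall>\<xi>\<in>\<Lambda>. saturated 2 \<xi> q"
        using extL[rule_format, OF fu gu] by blast
      have pq: "p \<subseteq>\<^sub>m q" using map_le_trans[OF ule[rule_format] q(1)] by (simp add: \<F>_def)
      have copy: "occurs E s q \<gamma>" if "f \<in> E" "f + \<gamma> \<in> Q" for f \<gamma>
        unfolding occurs_def
        using that(1) map_le_trans[OF ule[rule_format] q(1), of "place s (f + \<gamma>)"] that(2) by (auto simp: \<F>_def)
      have "dom q \<subseteq> L' + ?P"
      proof -
        have "Q \<subseteq> H + ?P" using QA by (auto simp: A_def)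
        then have "dom s + Q \<subseteq> dom s + (H + ?P)" by (rule set_plus_mono2[OF order_refl])
        then have copies: "dom s + Q \<subseteq> (dom s + H) + ?P" by (simp only: add.assoc)
        have "dom u \<subseteq> insert 0 (dom s + H) + ?P"
        proof
          fix x assume "x \<in> dom u"
          then consider "x \<in> ?P" | "x \<in> dom s + Q" unfolding domu by blast
          then show "x \<in> insert 0 (dom s + H) + ?P"
          proof cases
            case 1
            then have "0 + x \<in> insert 0 (dom s + H) + ?P" by (intro set_plus_intro) simp_all
            then show ?thesis by simp
          next
            case 2
            then have "x \<in> (dom s + H) + ?P" using copies by blast
            then show ?thesis by (rule set_plus_mono_left) blast
          qed
        qed
        then have "L + dom u \<subseteq> L' + ?P"
          unfolding L'_def add.assoc by (rule set_plus_mono2[OF order_refl])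
        then show ?thesis using q(3) by blast
      qed
      moreover have "saturated 2 (E, C, s) q"
        unfolding saturated_def prod.case
      proof (intro allI impI)
        fix \<gamma> assume h: "2 * card E \<le> 4 * card {f\<in>E. f + \<gamma> \<in> C + dom q}"
        define near where "near = {f\<in>E. f + \<gamma> \<in> C + (L + ?P)}"
        define close where "close = {f\<in>E. f + \<gamma> \<in> C + ?P}"
        define free where "free = {f\<in>E. f + \<gamma> \<in> A}"
        have fin: "finite near" "finite close" "finite free" "finite {f\<in>E. f + \<gamma> \<in> K + Q}"
          using E by (auto simp: near_def close_def free_def)
        have "{f\<in>E. f + \<gamma> \<in> C + dom q} \<subseteq> near \<union> {f\<in>E. f + \<gamma> \<in> K + Q}"
        proof clarify
          fix f assume f: "f \<in> E" "f + \<gamma> \<in> C + dom q" "f \<notin> near"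
          from f(2) obtain c y where cy: "f + \<gamma> = c + y" "c \<in> C" "y \<in> dom q" by (rule set_plus_elim)
          have "y \<in> L + dom u" using q(3) cy(3) by blast
          then obtain l x where lx: "y = l + x" "l \<in> L" "x \<in> dom u" by (rule set_plus_elim)
          have "x \<notin> ?P"
          proof
            assume "x \<in> ?P"
            then have "f + \<gamma> \<in> C + (L + ?P)" unfolding cy(1) lx(1) using cy lx by (intro set_plus_intro)
            then show False using f by (simp add: near_def)
          qed
          then have "x \<in> dom s + Q" using lx(3) unfolding domu by blast
          then obtain d g where dg: "x = d + g" "d \<in> dom s" "g \<in> Q" by (rule set_plus_elim)
          have "f + \<gamma> = (c + (l + d)) + g" unfolding cy(1) lx(1) dg(1) by (simp add: add.assoc)
          moreover have "(c + (l + d)) + g \<in> (C + (L + dom s)) + Q" using cy lx dg by (intro set_plus_intro)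
          ultimately have "f + \<gamma> \<in> (C + (L + dom s)) + Q" by simp
          then show "f + \<gamma> \<in> K + Q" by (rule set_plus_mono_left) (simp add: K_def)
        qed
        then have "card {f\<in>E. f + \<gamma> \<in> C + dom q} \<le> card near + card {f\<in>E. f + \<gamma> \<in> K + Q}"
          using fin by (meson card_Un_le card_mono finite_UnI order_trans)
        then have near: "card E \<le> 4 * card near" using h Qsparse[of \<gamma>] by linarith
        show "occurs E s q \<gamma>"
        proof (cases "close = {}")
          case True
          have "near \<subseteq> free"
          proof
            fix f assume f: "f \<in> near"
            then have "f + \<gamma> \<in> (C + L) + ?P" by (simp add: near_def add.assoc)
            then have "f + \<gamma> \<in> H + ?P" by (rule set_plus_mono_left) (simp add: H_def)
            then show "f \<in> free" using f True by (auto simp: near_def close_def free_def A_def)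
          qed
          then have "card near \<le> card free" using fin by (simp add: card_mono)
          then have "card E \<le> 4 * card free" using near by linarith
          then show ?thesis using Qhit[of \<gamma>] copy by (auto simp: free_def)
        next
          case False
          then obtain f0 where f0: "f0 \<in> E" "f0 + \<gamma> \<in> C + ?P" by (auto simp: close_def)
          show ?thesis
          proof (cases "3 * card E \<le> 4 * card close")
            case True
            then have "occurs E s p \<gamma>" using gp by (intro saturatedD[of 3 E C s p]) (auto simp: close_def)
            then show ?thesis using pq by (rule occurs_mono)
          next
            case False
            have "E \<subseteq> close \<union> free"
            proof
              fix f assume f: "f \<in> E"
              obtain c x where cx: "f0 + \<gamma> = c + x" "c \<in> C" "x \<in> ?P" using f0(2) by (rule set_plus_elim)
              then have "\<gamma> = - f0 + (c + x)" by (metis minus_add_cancel)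
              then have "f + \<gamma> = (f + (- f0 + c)) + x" by (simp add: add.assoc)
              then have "f + \<gamma> \<in> (E + (uminus ` E + C)) + ?P"
                using f f0 cx by (auto intro!: set_plus_intro)
              then have "f + \<gamma> \<in> H + ?P" by (rule set_plus_mono_left) (simp add: H_def)
              then show "f \<in> close \<union> free" using f by (auto simp: close_def free_def A_def)
            qed
            then have "card E \<le> card close + card free"
              using fin by (meson card_Un_le card_mono finite_UnI order_trans)
            then have "card E \<le> 4 * card free" using False by linarith
            then show ?thesis using Qhit[of \<gamma>] copy by (auto simp: free_def)
          qed
        qed
      qed
      ultimately show ?thesis using pq q by blast
    qed
    moreover have "finite L'" using L s fH by (simp add: L'_def finite_set_plus)
    ultimately show ?thesis unfolding extendable_def by blast
  qed
  then show ?thesis using fC by (intro exI[of _ C] exI[of _ m0]) (auto simp: C_def)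
qed

text \<open>
  The inequality \<open>12 * card C \<le> card E\<close> makes room for three new points: each of them is within the margin of at
  most \<open>card C\<close> elements of a window, together at most a quarter of the window.
\<close>

definition stage :: "'g::group_add demand set \<Rightarrow> 'g pattern \<Rightarrow> bool" where
  "stage \<Lambda> s \<longleftrightarrow> finite \<Lambda> \<and> extendable \<Lambda> \<and> finite (dom s) \<and> (\<forall>\<xi>\<in>\<Lambda>. saturated 2 \<xi> s) \<and>
     (\<forall>(E, C, r)\<in>\<Lambda>. finite E \<and> finite C \<and> 0 \<in> C \<and> 12 * card C \<le> card E)"

lemma card_meeting_le:
  fixes X :: "'g::group_add set"
  assumes "finite C" "finite X"
  shows "card {f\<in>E. f + \<gamma> \<in> C + X} \<le> card C * card X"
proof -
  have "card {f\<in>E. f + \<gamma> \<in> C + X} \<le> card (C + X)"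
    using assms by (intro card_inj_on_le[of "\<lambda>f. f + \<gamma>"]) (auto simp: inj_on_def finite_set_plus)
  then show ?thesis using card_set_plus_le[OF assms] by linarith
qed

text \<open>
  One step of the construction of \<open>x\<close>. Two new points \<open>t\<close> and \<open>t + \<gamma>\<close> with different values
  exclude \<open>\<gamma>\<close> from the stabilizer, and \<open>w\<close> is added so that eventually every point is decided. For the demand
  created in this step the pattern with these points is saturated vacuously, since \<open>E\<close> is chosen large
  compared with it.
\<close>

lemma stage_step:
  fixes \<Lambda> :: "'g::group_add demand set"
  assumes inf: "infinite (UNIV :: 'g set)" and adm: "stage \<Lambda> s"
    and \<F>: "\<And>m. \<exists>E\<in>\<F>. finite E \<and> m \<le> card E"
  obtains E C s' where "E \<in> \<F>" "stage (insert (E, C, s) \<Lambda>) s'" "s \<subseteq>\<^sub>m s'" "w \<in> dom s'"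
    "\<gamma> \<noteq> 0 \<Longrightarrow> \<exists>t\<in>dom s'. t + \<gamma> \<in> dom s' \<and> s' t \<noteq> s' (t + \<gamma>)"
proof -
  have \<Lambda>: "finite \<Lambda>" "extendable \<Lambda>" "finite (dom s)" "\<And>\<xi>. \<xi> \<in> \<Lambda> \<Longrightarrow> saturated 2 \<xi> s"
    and \<Lambda>': "\<And>E C r. (E, C, r) \<in> \<Lambda> \<Longrightarrow> finite E \<and> finite C \<and> 0 \<in> C \<and> 12 * card C \<le> card E"
    using adm unfolding stage_def by auto
  have ne: "finite E \<and> E \<noteq> {} \<and> finite C" if "(E, C, r) \<in> \<Lambda>" for E C r
    using \<Lambda>'[OF that] by (auto simp: card_eq_0_iff)
  have "\<exists>C m0. finite C \<and> 0 \<in> C \<and>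
           (\<forall>E. finite E \<longrightarrow> m0 \<le> card E \<longrightarrow> extendable (insert (E, C, s) \<Lambda>))"
  proof (rule extendable_insert[OF \<Lambda>(1)])
    show "saturated 3 \<xi> s" if "\<xi> \<in> \<Lambda>" for \<xi> using \<Lambda>(4)[OF that] by (rule saturated_mono) simp
  qed (use ne \<Lambda>(2,3) in auto)
  then obtain C m0 where C: "finite C" "0 \<in> C"
    and m0: "\<forall>E. finite E \<longrightarrow> m0 \<le> card E \<longrightarrow> extendable (insert (E, C, s) \<Lambda>)"
    by (elim exE conjE)
  define m where "m = max m0 (12 * card C * (card (dom s) + 3))"
  obtain E where E: "E \<in> \<F>" "finite E" "m \<le> card E" using \<F> by blast
  obtain t where t: "t \<notin> dom s" "t + \<gamma> \<notin> dom s"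
  proof -
    have "finite (dom s \<union> (\<lambda>h. h - \<gamma>) ` dom s)" using \<Lambda> by simp
    then obtain t where "t \<notin> dom s \<union> (\<lambda>h. h - \<gamma>) ` dom s" using inf ex_new_if_finite by metis
    then have "t \<notin> dom s" "t + \<gamma> \<notin> dom s" by (auto simp: image_iff) (metis add_diff_cancel domI)
    then show ?thesis by (rule that)
  qed
  let ?new = "{w, t, t + \<gamma>}"
  \<comment> \<open>Values already prescribed by \<open>s\<close> take precedence over the value at \<open>w\<close>.\<close>
  define p where "p = [w \<mapsto> False, t \<mapsto> True, t + \<gamma> \<mapsto> False] ++ s"
  have sp: "s \<subseteq>\<^sub>m p" by (auto simp: p_def)
  have domp: "dom p = dom s \<union> ?new" by (auto simp: p_def)
  have fp: "finite (dom p)" using \<Lambda> by (simp add: domp)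
  have cnew: "card ?new \<le> 3" by (auto simp: card_insert_if)
  have old: "saturated 3 \<xi> p" if \<xi>: "\<xi> \<in> \<Lambda>" for \<xi>
  proof -
    obtain E' C' r where [simp]: "\<xi> = (E', C', r)" by (cases \<xi>)
    note \<xi>' = \<Lambda>'[OF \<xi>[unfolded \<open>\<xi> = _\<close>]]
    have "occurs E' r p \<delta>" if h: "3 * card E' \<le> 4 * card {f\<in>E'. f + \<delta> \<in> C' + dom p}" for \<delta>
    proof -
      have "{f\<in>E'. f + \<delta> \<in> C' + dom p} \<subseteq> {f\<in>E'. f + \<delta> \<in> C' + dom s} \<union> {f\<in>E'. f + \<delta> \<in> C' + ?new}"
        by (auto simp: domp set_plus_def)
      then have "card {f\<in>E'. f + \<delta> \<in> C' + dom p}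
          \<le> card {f\<in>E'. f + \<delta> \<in> C' + dom s} + card {f\<in>E'. f + \<delta> \<in> C' + ?new}"
        using \<xi>' by (intro order_trans[OF card_mono card_Un_le]) auto
      moreover have "card {f\<in>E'. f + \<delta> \<in> C' + ?new} \<le> card C' * 3"
        using \<xi>' cnew by (intro order_trans[OF card_meeting_le] mult_le_mono) auto
      ultimately have "2 * card E' \<le> 4 * card {f\<in>E'. f + \<delta> \<in> C' + dom s}" using h \<xi>' by linarith
      then have "occurs E' r s \<delta>" using saturatedD[of 2 E' C' r s] \<Lambda>(4)[OF \<xi>] by auto
      then show ?thesis using sp by (rule occurs_mono)
    qed
    then show ?thesis by (simp add: saturated_def)
  qed
  have C0: "card C \<ge> 1" using C by (simp add: Suc_le_eq card_gt_0_iff) blast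
  have E': "12 * card C * (card (dom s) + 3) \<le> card E" "m0 \<le> card E" using E by (auto simp: m_def)
  have "saturated 3 (E, C, s) p"
  proof -
    have "4 * card {f\<in>E. f + \<delta> \<in> C + dom p} < 3 * card E" for \<delta>
    proof -
      have "card {f\<in>E. f + \<delta> \<in> C + dom p} \<le> card C * card (dom p)"
        using C(1) fp by (rule card_meeting_le)
      also have "\<dots> \<le> card C * (card (dom s) + 3)"
        unfolding domp using cnew by (intro mult_le_mono order_trans[OF card_Un_le]) auto
      finally have "12 * card {f\<in>E. f + \<delta> \<in> C + dom p} \<le> card E" using E' by linarith
      moreover have "12 * card C * (card (dom s) + 3) > 0" using C0 by simp
      ultimately show ?thesis using E' by linarith
    qed
    then show ?thesis unfolding saturated_def prod.case by (meson not_less)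
  qed
  then have all: "\<forall>\<xi>\<in>insert (E, C, s) \<Lambda>. saturated 3 \<xi> p" using old by auto
  have ext: "extendable (insert (E, C, s) \<Lambda>)" using m0 E E' by auto
  then obtain s' where s': "p \<subseteq>\<^sub>m s'" "finite (dom s')" "\<forall>\<xi>\<in>insert (E, C, s) \<Lambda>. saturated 2 \<xi> s'"
    using fp all unfolding extendable_def by metis
  show ?thesis
  proof (rule that[OF E(1)])
    have "12 * card C \<le> card E" using E' by (simp add: algebra_simps)
    then show "stage (insert (E, C, s) \<Lambda>) s'"
      unfolding stage_def using \<Lambda> \<Lambda>' ext s' E C by auto
    show "s \<subseteq>\<^sub>m s'" using sp s'(1) by (rule map_le_trans)
    show "w \<in> dom s'" using map_le_implies_dom_le[OF s'(1)] domp by auto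
    show "\<exists>t\<in>dom s'. t + \<gamma> \<in> dom s' \<and> s' t \<noteq> s' (t + \<gamma>)" if "\<gamma> \<noteq> 0"
    proof -
      have "s t = None" "s (t + \<gamma>) = None" using t by auto
      moreover have "t \<noteq> t + \<gamma>"
        using that add_left_cancel[of t 0 \<gamma>] by simp
      ultimately have "p t = Some True" "p (t + \<gamma>) = Some False" by (simp_all add: p_def map_add_def)
      then have "s' t = Some True" "s' (t + \<gamma>) = Some False"
        using s'(1) by (metis domI map_le_def)+
      then show ?thesis by (intro bexI[of _ t]) auto
    qed
  qed
qed

text \<open>
  In the limit of the stages every demand holds for all windows: a window is finite, hence contained in
  the domain of some later pattern, whose saturation then provides the copy.
\<close>

lemma exists_syndetically_recurrent_point:
  fixes \<F> :: "nat \<Rightarrow> 'g::{group_add, countable} set set"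
  assumes inf: "infinite (UNIV :: 'g set)"
    and \<F>: "\<And>i m. \<exists>E\<in>\<F> i. finite E \<and> m \<le> card E"
  obtains x :: "'g \<Rightarrow> bool" and D :: "nat \<Rightarrow> 'g set"
  where "x \<in> Free" "\<And>i j. i \<le> j \<Longrightarrow> D i \<subseteq> D j" "\<And>h. \<exists>i. h \<in> D i"
    "\<And>i. \<exists>E\<in>\<F> i. \<forall>\<gamma>. \<exists>f\<in>E. \<forall>d\<in>D i. shift (f + \<gamma>) x d = x d"
proof -
  define R where "R i S S' \<longleftrightarrow> (\<exists>E\<in>\<F> i. \<exists>C. fst S' = insert (E, C, snd S) (fst S)) \<and>
      snd S \<subseteq>\<^sub>m snd S' \<and> from_nat i \<in> dom (snd S') \<and>
      (from_nat i \<noteq> (0 :: 'g) \<longrightarrow>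
        (\<exists>t\<in>dom (snd S'). t + from_nat i \<in> dom (snd S') \<and> snd S' t \<noteq> snd S' (t + from_nat i)))"
    for i and S S' :: "'g demand set \<times> 'g pattern"
  have "\<exists>S. \<forall>i. stage (fst (S i)) (snd (S i)) \<and> R i (S i) (S (Suc i))"
  proof (rule dependent_nat_choice)
    have "stage ({} :: 'g demand set) Map.empty"
      by (simp add: stage_def extendable_empty)
    then show "\<exists>S :: 'g demand set \<times> 'g pattern. stage (fst S) (snd S)"
      by (intro exI[of _ "({}, Map.empty)"]) simp
  next
    fix S :: "'g demand set \<times> 'g pattern" and i
    assume adm: "stage (fst S) (snd S)"
    show "\<exists>S'. stage (fst S') (snd S') \<and> R i S S'"
    proof (rule stage_step[OF inf adm \<F>[of i], where w = "from_nat i" and \<gamma> = "from_nat i"])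
      fix E C s'
      assume "E \<in> \<F> i" "stage (insert (E, C, snd S) (fst S)) s'" "snd S \<subseteq>\<^sub>m s'" "from_nat i \<in> dom s'"
        "from_nat i \<noteq> (0 :: 'g) \<Longrightarrow> \<exists>t\<in>dom s'. t + from_nat i \<in> dom s' \<and> s' t \<noteq> s' (t + from_nat i)"
      then show ?thesis
        unfolding R_def by (intro exI[of _ "(insert (E, C, snd S) (fst S), s')"]) auto
    qed
  qed
  then obtain S where S: "\<forall>i. stage (fst (S i)) (snd (S i)) \<and> R i (S i) (S (Suc i))" by (elim exE)
  define \<Lambda> where "\<Lambda> i = fst (S i)" for i
  define s where "s i = snd (S i)" for i
  have adm: "stage (\<Lambda> i) (s i)" for i using S by (simp add: \<Lambda>_def s_def)
  have chain: "\<exists>E\<in>\<F> i. \<exists>C. \<Lambda> (Suc i) = insert (E, C, s i) (\<Lambda> i)" "s i \<subseteq>\<^sub>m s (Suc i)" "from_nat i \<in> dom (s (Suc i))"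
      "from_nat i \<noteq> (0 :: 'g) \<longrightarrow> (\<exists>t\<in>dom (s (Suc i)). t + from_nat i \<in> dom (s (Suc i)) \<and> s (Suc i) t \<noteq> s (Suc i) (t + from_nat i))"
    for i using S[rule_format, of i] unfolding R_def \<Lambda>_def s_def by blast+
  have smono: "s i \<subseteq>\<^sub>m s j" if "i \<le> j" for i j
    using that by (induction rule: dec_induct) (auto intro: map_le_trans chain(2))
  have \<Lambda>mono: "\<Lambda> i \<subseteq> \<Lambda> j" if "i \<le> j" for i j
    using that
  proof (induction rule: dec_induct)
    case (step n) then show ?case using chain(1)[of n] by auto
  qed simp
  have cover: "h \<in> dom (s (Suc (to_nat h)))" for h using chain(3)[of "to_nat h"] by simp
  define x where "x h = the (s (Suc (to_nat h)) h)" for h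
  have x: "s j h = Some (x h)" if hj: "h \<in> dom (s j)" for j h
  proof -
    have "s j h = s (max j (Suc (to_nat h))) h" "s (Suc (to_nat h)) h = s (max j (Suc (to_nat h))) h"
      using smono[of j "max j (Suc (to_nat h))"] smono[of "Suc (to_nat h)" "max j (Suc (to_nat h))"] hj cover[of h]
      by (auto simp: map_le_def)
    then have "s (Suc (to_nat h)) h = s j h" by simp
    moreover obtain b where "s j h = Some b" using domD[OF hj] by (elim exE)
    ultimately show ?thesis by (simp add: x_def)
  qed
  show ?thesis
  proof (rule that[of x "\<lambda>i. dom (s i)"])
    have "\<gamma> = 0" if "shift \<gamma> x = x" for \<gamma>
    proof (rule ccontr)
      assume "\<gamma> \<noteq> 0"
      then obtain t where t: "t \<in> dom (s (Suc (to_nat \<gamma>)))" "t + \<gamma> \<in> dom (s (Suc (to_nat \<gamma>)))"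
        "s (Suc (to_nat \<gamma>)) t \<noteq> s (Suc (to_nat \<gamma>)) (t + \<gamma>)"
        using chain(4)[of "to_nat \<gamma>"] unfolding from_nat_to_nat by blast
      then have "x t \<noteq> x (t + \<gamma>)" using x[OF t(1)] x[OF t(2)] by simp
      moreover have "shift \<gamma> x t = x t" using that by simp
      ultimately show False by (simp add: shift_def)
    qed
    moreover have "shift 0 x = x" by (simp add: shift_def)
    ultimately show "x \<in> Free" by (auto simp: Free_def stabilizer_def)
    show "dom (s i) \<subseteq> dom (s j)" if "i \<le> j" for i j using smono[OF that] by (rule map_le_implies_dom_le)
    show "\<exists>i. h \<in> dom (s i)" for h using cover by blast
    fix i
    obtain E C where E: "E \<in> \<F> i" "\<Lambda> (Suc i) = insert (E, C, s i) (\<Lambda> i)" using chain(1)[of i] by blast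
    have EC: "finite E" "0 \<in> C" using adm[of "Suc i"] E(2) by (auto simp: stage_def)
    have "\<exists>f\<in>E. \<forall>d\<in>dom (s i). shift (f + \<gamma>) x d = x d" for \<gamma>
    proof -
      define j where "j = Max (insert (Suc i) ((\<lambda>f. Suc (to_nat (f + \<gamma>))) ` E))"
      have j: "Suc i \<le> j" "\<And>f. f \<in> E \<Longrightarrow> Suc (to_nat (f + \<gamma>)) \<le> j"
        unfolding j_def using EC by (auto intro!: Max_ge)
      have "f + \<gamma> \<in> C + dom (s j)" if "f \<in> E" for f
      proof -
        have "f + \<gamma> \<in> dom (s j)" using cover smono[OF j(2)[OF that]] map_le_implies_dom_le by blast
        with EC(2) have "0 + (f + \<gamma>) \<in> C + dom (s j)" by (rule set_plus_intro)
        then show ?thesis by simp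
      qed
      then have "{f\<in>E. f + \<gamma> \<in> C + dom (s j)} = E" by auto
      moreover have "saturated 2 (E, C, s i) (s j)"
        using adm[of j] \<Lambda>mono[OF j(1)] E(2) by (auto simp: stage_def)
      ultimately have "occurs E (s i) (s j) \<gamma>" by (intro saturatedD[of 2 E C]) auto
      then obtain f where f: "f \<in> E" "place (s i) (f + \<gamma>) \<subseteq>\<^sub>m s j" by (auto simp: occurs_def)
      have "shift (f + \<gamma>) x d = x d" if d: "d \<in> dom (s i)" for d
      proof -
        have "place (s i) (f + \<gamma>) (d + (f + \<gamma>)) = s i d" by (simp add: place_def)
        then have "s j (d + (f + \<gamma>)) = s i d" using f(2) d by (metis domIff map_le_def)
        then show ?thesis using x[of d i] x[of "d + (f + \<gamma>)" j] d by (auto simp: shift_def)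
      qed
      then show ?thesis using f by blast
    qed
    then show "\<exists>E\<in>\<F> i. \<forall>\<gamma>. \<exists>f\<in>E. \<forall>d\<in>dom (s i). shift (f + \<gamma>) x d = x d" using E(1) by blast
  qed
qed

section \<open>Baire category relative to a compact set\<close>

text \<open>
  Meagerness of \<open>A \<inter> X\<close> in the subspace \<open>X\<close>, expressed with closed sets of the ambient space that contain
  no nonempty relatively open subset of \<open>X\<close>.
\<close>

definition meager_in :: "'a::topological_space set \<Rightarrow> 'a set \<Rightarrow> bool" where
  "meager_in X A \<longleftrightarrow> (\<exists>C :: nat \<Rightarrow> 'a set.
     (\<forall>n. closed (C n) \<and> (\<forall>U. open U \<longrightarrow> U \<inter> X \<noteq> {} \<longrightarrow> \<not> U \<inter> X \<subseteq> C n)) \<and> A \<inter> X \<subseteq> (\<Union>n. C n))"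

lemma meager_in_closed:
  assumes "closed C" "\<And>U. open U \<Longrightarrow> U \<inter> X \<noteq> {} \<Longrightarrow> \<not> U \<inter> X \<subseteq> C"
  shows "meager_in X C"
  unfolding meager_in_def using assms by (intro exI[of _ "\<lambda>_. C"]) auto

lemma meager_in_subset: "meager_in X B \<Longrightarrow> A \<inter> X \<subseteq> B \<Longrightarrow> meager_in X A"
proof -
  assume "meager_in X B" "A \<inter> X \<subseteq> B"
  moreover from this have "A \<inter> X \<subseteq> B \<inter> X" by blast
  ultimately show ?thesis unfolding meager_in_def by (elim ex_forward) (blast intro: order_trans)
qed

lemma meager_in_UN:
  fixes A :: "'i::countable \<Rightarrow> 'a::topological_space set"
  assumes "\<And>i. meager_in X (A i)"
  shows "meager_in X (\<Union>i. A i)"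
proof -
  have "\<forall>i. \<exists>C :: nat \<Rightarrow> 'a set.
      (\<forall>n. closed (C n) \<and> (\<forall>U. open U \<longrightarrow> U \<inter> X \<noteq> {} \<longrightarrow> \<not> U \<inter> X \<subseteq> C n)) \<and> A i \<inter> X \<subseteq> (\<Union>n. C n)"
    using assms unfolding meager_in_def by blast
  then obtain C :: "'i \<Rightarrow> nat \<Rightarrow> 'a set" where "\<forall>i.
      (\<forall>n. closed (C i n) \<and> (\<forall>U. open U \<longrightarrow> U \<inter> X \<noteq> {} \<longrightarrow> \<not> U \<inter> X \<subseteq> C i n)) \<and> A i \<inter> X \<subseteq> (\<Union>n. C i n)"
    unfolding choice_iff by blast
  then have C: "\<And>i n. closed (C i n)" "\<And>i n U. open U \<Longrightarrow> U \<inter> X \<noteq> {} \<Longrightarrow> \<not> U \<inter> X \<subseteq> C i n"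
    "\<And>i. A i \<inter> X \<subseteq> (\<Union>n. C i n)" by blast+
  define C' where "C' k = (case from_nat k of (i, n) \<Rightarrow> C i n)" for k
  have "C i n = C' (to_nat (i, n))" for i n by (simp add: C'_def)
  then have "C i n \<subseteq> (\<Union>k. C' k)" for i n by blast
  then have "A i \<inter> X \<subseteq> (\<Union>k. C' k)" for i using C(3)[of i] by (meson UN_least order_trans)
  then have "(\<Union>i. A i) \<inter> X \<subseteq> (\<Union>k. C' k)" by blast
  moreover have "closed (C' k)" for k using C(1) by (simp add: C'_def split: prod.split)
  moreover have "\<not> U \<inter> X \<subseteq> C' k" if "open U" "U \<inter> X \<noteq> {}" for U k
    using C(2)[OF that] by (simp add: C'_def split: prod.split)
  ultimately show ?thesis unfolding meager_in_def by (intro exI[of _ C']) simp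
qed

lemma meager_in_Un:
  assumes "meager_in X A" "meager_in X B"
  shows "meager_in X (A \<union> B)"
proof -
  have "meager_in X (\<Union>b. if b then A else B)" using assms by (intro meager_in_UN) simp
  then show ?thesis by (rule meager_in_subset) auto
qed

lemma open_not_meager_in_compact:
  fixes X :: "'a::topological_space set"
  assumes Hausdorff: "Hausdorff_space (euclidean :: 'a topology)" and "compact X" "open U" "U \<inter> X \<noteq> {}"
  shows "\<not> meager_in X U"
proof
  assume "meager_in X U"
  then obtain C :: "nat \<Rightarrow> 'a set" where C: "\<And>n. closed (C n)"
    "\<And>n U. open U \<Longrightarrow> U \<inter> X \<noteq> {} \<Longrightarrow> \<not> U \<inter> X \<subseteq> C n" "U \<inter> X \<subseteq> (\<Union>n. C n)"
    unfolding meager_in_def by metis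
  let ?T = "top_of_set X"
  have cT: "compact_space ?T" using assms(2) by (simp add: compact_space_subtopology)
  moreover have "Hausdorff_space ?T" using Hausdorff by (rule Hausdorff_space_subtopology)
  ultimately have "locally_compact_space ?T \<and> regular_space ?T"
    by (simp add: compact_Hausdorff_imp_regular_space compact_imp_locally_compact_space)
  then have "?T interior_of \<Union> (range (\<lambda>n. C n \<inter> X)) = {}"
  proof (intro Baire_category_alt disjI2)
    fix S assume "S \<in> range (\<lambda>n. C n \<inter> X)"
    then obtain n where S: "S = C n \<inter> X" by auto
    have "?T interior_of S = {}"
    proof (rule ccontr)
      assume "?T interior_of S \<noteq> {}"
      moreover have "openin ?T (?T interior_of S)" by simp
      then obtain V where "open V" "?T interior_of S = X \<inter> V" unfolding openin_open by blast
      moreover have "?T interior_of S \<subseteq> S" by (rule interior_of_subset)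
      ultimately show False using C(2)[of V n] S by auto
    qed
    then show "closedin ?T S \<and> ?T interior_of S = {}"
      using C(1)[of n] by (auto simp: S closedin_closed)
  qed auto
  moreover have "U \<inter> X \<subseteq> ?T interior_of \<Union> (range (\<lambda>n. C n \<inter> X))"
    using assms(3) C(3) by (intro interior_of_maximal) (auto simp: openin_open)
  ultimately show False using assms(4) by blast
qed

text \<open>
  The sets that differ from an open set by a meager set form a sigma-algebra. For complements, the open set
  \<open>U\<close> is replaced by the relative interior of its complement, from which the complement differs by
  a nowhere dense closed set.
\<close>

lemma borel_baire_property:
  fixes A :: "'a::topological_space set"
  assumes "A \<in> sets borel"
  shows "\<exists>U. open U \<and> meager_in X ((A - U) \<union> (U - A))"
proof -
  have empty: "meager_in X {}" by (rule meager_in_closed) auto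
  have "A \<in> sigma_sets UNIV {S. open S}" using assms by (simp add: borel_def)
  then show ?thesis
  proof induction
    case (Basic A)
    then show ?case using empty by (intro exI[of _ A]) auto
  next
    case Empty
    then show ?case using empty by (intro exI[of _ "{}"]) auto
  next
    case (Compl A)
    then obtain U where U: "open U" "meager_in X ((A - U) \<union> (U - A))" by blast
    define V where "V = \<Union>{V. open V \<and> V \<inter> X \<subseteq> - U}"
    have V: "open V" "V \<inter> X \<subseteq> - U" by (auto simp: V_def)
    have "meager_in X (- U - V)"
    proof (rule meager_in_closed)
      show "closed (- U - V)" using U V by (simp add: closed_Diff closed_Compl)
      fix W assume "open W" "W \<inter> X \<noteq> {}"
      show "\<not> W \<inter> X \<subseteq> - U - V"
      proof
        assume "W \<inter> X \<subseteq> - U - V"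
        then have "W \<subseteq> V" using \<open>open W\<close> by (auto simp: V_def)
        then show False using \<open>W \<inter> X \<subseteq> - U - V\<close> \<open>W \<inter> X \<noteq> {}\<close> by auto
      qed
    qed
    then have "meager_in X (((A - U) \<union> (U - A)) \<union> (- U - V))"
      using meager_in_Un[OF U(2)] by blast
    then have "meager_in X ((UNIV - A - V) \<union> (V - (UNIV - A)))"
      by (rule meager_in_subset) (use V in auto)
    then show ?case using V by blast
  next
    case (Union A)
    then obtain U where U: "\<And>i. open (U i)" "\<And>i. meager_in X ((A i - U i) \<union> (U i - A i))" by metis
    have "meager_in X (\<Union>i. (A i - U i) \<union> (U i - A i))" by (intro meager_in_UN U)
    then have "meager_in X (((\<Union>i. A i) - (\<Union>i. U i)) \<union> ((\<Union>i. U i) - (\<Union>i. A i)))"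
      by (rule meager_in_subset) auto
    then show ?case using U by (intro exI[of _ "\<Union>i. U i"]) auto
  qed
qed

lemma borel_nonmeager_comeager_open:
  assumes "A \<in> sets borel" "\<not> meager_in X A"
  obtains U where "open U" "U \<inter> X \<noteq> {}" "meager_in X (U - A)"
proof -
  obtain U where U: "open U" "meager_in X ((A - U) \<union> (U - A))"
    using borel_baire_property[OF assms(1)] by blast
  have "U \<inter> X \<noteq> {}"
    using assms(2) meager_in_subset[OF U(2), of A] by blast
  moreover have "meager_in X (U - A)" using U(2) by (rule meager_in_subset) auto
  ultimately show ?thesis using that U by blast
qed

section \<open>The shift action and its orbit closures\<close>

lemma shift_shift: "shift a (shift b x) = shift (a + b) x"
  by (simp add: shift_def add.assoc)

lemma shift_0: "shift 0 x = x"
  by (simp add: shift_def)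

lemma continuous_on_shift: "continuous_on UNIV (shift \<gamma> :: ('g::group_add \<Rightarrow> bool) \<Rightarrow> _)"
  unfolding shift_def
  by (intro continuous_on_coordinatewise_then_product continuous_on_product_coordinates)

lemma open_shift_vimage: "open U \<Longrightarrow> open (shift \<gamma> -` U)"
  by (rule open_vimage[OF _ continuous_on_shift])

lemma closed_shift_vimage: "closed C \<Longrightarrow> closed (shift \<gamma> -` C)"
  by (rule closed_vimage[OF _ continuous_on_shift])

lemma borel_shift_vimage: "A \<in> sets borel \<Longrightarrow> shift \<gamma> -` A \<in> sets borel"
  using measurable_sets[OF borel_measurable_continuous_onI[OF continuous_on_shift], of A \<gamma>] by simp

text \<open>
  Each shift acts on an invariant \<open>X\<close> as a homeomorphism.
\<close>

lemma meager_in_shift_vimage: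
  assumes inv: "\<And>\<gamma> y. y \<in> X \<Longrightarrow> shift \<gamma> y \<in> X" and "meager_in X A"
  shows "meager_in X (shift \<gamma> -` A)"
proof -
  obtain C where C: "\<And>n. closed (C n)" "\<And>n U. open U \<Longrightarrow> U \<inter> X \<noteq> {} \<Longrightarrow> \<not> U \<inter> X \<subseteq> C n"
    "A \<inter> X \<subseteq> (\<Union>n :: nat. C n)"
    using assms(2) unfolding meager_in_def by metis
  have "\<not> U \<inter> X \<subseteq> shift \<gamma> -` C n" if U: "open U" "U \<inter> X \<noteq> {}" for U n
  proof
    assume h: "U \<inter> X \<subseteq> shift \<gamma> -` C n"
    obtain y where y: "y \<in> U" "y \<in> X" using U by blast
    have "shift \<gamma> y \<in> shift (- \<gamma>) -` U \<inter> X" using y inv by (simp add: shift_shift shift_0)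
    then have "\<not> shift (- \<gamma>) -` U \<inter> X \<subseteq> C n" using C(2) open_shift_vimage[OF U(1)] by blast
    then obtain z where z: "shift (- \<gamma>) z \<in> U" "z \<in> X" "z \<notin> C n" by auto
    then have "shift (- \<gamma>) z \<in> U \<inter> X" using inv by auto
    then have "shift \<gamma> (shift (- \<gamma>) z) \<in> C n" using h by blast
    then show False using z by (simp add: shift_shift shift_0)
  qed
  moreover have "shift \<gamma> -` A \<inter> X \<subseteq> (\<Union>n. shift \<gamma> -` C n)"
  proof
    fix y assume "y \<in> shift \<gamma> -` A \<inter> X"
    then have "shift \<gamma> y \<in> A \<inter> X" using inv by simp
    then show "y \<in> (\<Union>n. shift \<gamma> -` C n)" using C(3) by blast
  qed
  moreover have "closed (shift \<gamma> -` C n)" for n using C(1) by (rule closed_shift_vimage)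
  ultimately show ?thesis
    unfolding meager_in_def by (intro exI[of _ "\<lambda>n. shift \<gamma> -` C n"]) simp
qed

lemma open_contains_cylinder:
  fixes x :: "'g \<Rightarrow> bool"
  assumes "open U" "x \<in> U"
  obtains W where "finite W" "\<And>y. (\<And>d. d \<in> W \<Longrightarrow> y d = x d) \<Longrightarrow> y \<in> U"
proof -
  obtain V where V: "finite {i. V i \<noteq> UNIV}" "x \<in> Pi\<^sub>E UNIV V" "Pi\<^sub>E UNIV V \<subseteq> U"
    using assms unfolding open_fun_def openin_product_topology_alt by force
  have "y \<in> U" if "\<And>d. d \<in> {i. V i \<noteq> UNIV} \<Longrightarrow> y d = x d" for y
  proof -
    have "y i \<in> V i" for i using that[of i] V(2) by (cases "V i = UNIV") auto
    then have "y \<in> Pi\<^sub>E UNIV V" by auto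
    then show ?thesis using V(3) by blast
  qed
  then show ?thesis using that V(1) by blast
qed

lemma compact_UNIV_bool_fun: "compact (UNIV :: ('g \<Rightarrow> bool) set)"
proof -
  have "compact_space (euclidean :: bool topology)"
    by (simp add: compact_space_def compactin_euclidean_iff finite_imp_compact)
  then have "compact_space (product_topology (\<lambda>_ :: 'g. euclidean :: bool topology) UNIV)"
    by (simp add: compact_space_product_topology)
  then show ?thesis
    by (simp add: euclidean_product_topology compact_space_def compactin_euclidean_iff)
qed

lemma Hausdorff_bool_fun: "Hausdorff_space (euclidean :: ('g \<Rightarrow> bool) topology)"
proof -
  have "Hausdorff_space (euclidean :: bool topology)"
    unfolding Hausdorff_space_def disjnt_def using hausdorff by (metis open_openin)
  then have "Hausdorff_space (product_topology (\<lambda>_ :: 'g. euclidean :: bool topology) UNIV)"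
    by (simp add: Hausdorff_space_product_topology)
  then show ?thesis by (simp add: euclidean_product_topology)
qed

lemma closed_Collect_coordinate: "closed {y :: 'g \<Rightarrow> bool. y a = b}"
proof -
  have "closed ((\<lambda>y :: 'g \<Rightarrow> bool. y a) -` {b})"
    by (intro closed_vimage continuous_on_product_coordinates closed_singleton)
  then show ?thesis by (simp add: vimage_def)
qed

lemma closed_shift_fixed: "closed {y :: 'g::group_add \<Rightarrow> bool. shift \<gamma> y = y}"
proof -
  have "closed {y :: 'g \<Rightarrow> bool. y (\<delta> + \<gamma>) = y \<delta>}" for \<delta>
    by (intro closed_Collect_eq continuous_on_product_coordinates)
  then have "closed (\<Inter>\<delta>. {y :: 'g \<Rightarrow> bool. y (\<delta> + \<gamma>) = y \<delta>})" by (intro closed_INT) auto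
  moreover have "(\<Inter>\<delta>. {y. y (\<delta> + \<gamma>) = y \<delta>}) = {y. shift \<gamma> y = y}" by (auto simp: shift_def fun_eq_iff)
  ultimately show ?thesis by simp
qed

lemma Free_iff: "x \<in> Free \<longleftrightarrow> (\<forall>\<gamma>. shift \<gamma> x = x \<longrightarrow> \<gamma> = 0)"
  unfolding Free_def stabilizer_def using shift_0 by blast

lemma shift_in_Free: "x \<in> Free \<Longrightarrow> shift \<delta> x \<in> Free"
  unfolding Free_iff
proof (intro allI impI)
  fix \<gamma> assume h: "\<forall>\<gamma>. shift \<gamma> x = x \<longrightarrow> \<gamma> = 0" and "shift \<gamma> (shift \<delta> x) = shift \<delta> x"
  then have "shift (- \<delta>) (shift \<gamma> (shift \<delta> x)) = x" by (simp add: shift_shift shift_0)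
  then have "- \<delta> + (\<gamma> + \<delta>) = 0" using h by (simp only: shift_shift)
  then show "\<gamma> = 0" by (metis add.right_neutral add_minus_cancel add_right_cancel add_0)
qed

lemma Free_borel: "(Free :: ('g::{group_add, countable} \<Rightarrow> bool) set) \<in> sets borel"
proof -
  have "Free = (\<Inter>\<gamma> \<in> - {0}. - {y :: 'g \<Rightarrow> bool. shift \<gamma> y = y})" by (auto simp: Free_iff)
  moreover have "\<dots> \<in> sets borel"
  proof (cases "- {0 :: 'g} = {}")
    case False
    then show ?thesis
      by (intro sets.countable_INT') (auto intro!: borel_open simp: closed_shift_fixed open_Compl)
  qed (simp add: borel_open)
  ultimately show ?thesis by simp
qed

lemma shift_image_eq: "shift \<sigma> ` B = shift (- \<sigma>) -` B"
proof (intro equalityI subsetI)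
  fix z assume "z \<in> shift (- \<sigma>) -` B"
  then show "z \<in> shift \<sigma> ` B"
    by (intro image_eqI[of _ _ "shift (- \<sigma>) z"]) (simp_all add: shift_shift shift_0)
next
  fix z assume "z \<in> shift \<sigma> ` B"
  then obtain b where "b \<in> B" "z = shift \<sigma> b" by blast
  then show "z \<in> shift (- \<sigma>) -` B" by (simp add: shift_shift shift_0)
qed

lemma translates_borel:
  assumes "finite F" "B \<in> sets borel"
  shows "translates F B \<in> sets borel"
proof -
  have "translates F B = (\<Union>\<sigma>\<in>F. shift (- \<sigma>) -` B)"
    unfolding shift_image_eq[symmetric] translates_def by blast
  then show ?thesis
    using sets.finite_UN[OF assms(1) borel_shift_vimage[OF assms(2)]] by simp
qed

lemma shift_in_orbit_closure:
  assumes "y \<in> closure (range (\<lambda>\<delta>. shift \<delta> x))"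
  shows "shift \<gamma> y \<in> closure (range (\<lambda>\<delta>. shift \<delta> x))"
proof -
  have "shift \<gamma> ` closure (range (\<lambda>\<delta>. shift \<delta> x)) \<subseteq> closure (range (\<lambda>\<delta>. shift \<delta> x))"
  proof (rule image_closure_subset)
    show "continuous_on (closure (range (\<lambda>\<delta>. shift \<delta> x))) (shift \<gamma>)"
      using continuous_on_shift by (rule continuous_on_subset) simp
    have "shift \<gamma> (shift \<delta> x) \<in> range (\<lambda>\<delta>. shift \<delta> x)" for \<delta> by (simp add: shift_shift)
    then show "shift \<gamma> ` range (\<lambda>\<delta>. shift \<delta> x) \<subseteq> closure (range (\<lambda>\<delta>. shift \<delta> x))"
      using closure_subset by blast
  qed simp
  then show ?thesis using assms by blast
qed

text \<open>
  For each \<open>\<gamma> \<noteq> 0\<close> the points fixed by \<open>\<gamma>\<close> form a closed set that misses the dense orbit of \<open>x\<close>.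
\<close>

lemma meager_in_orbit_closure_not_Free:
  fixes x :: "'g::{group_add, countable} \<Rightarrow> bool"
  assumes "x \<in> Free"
  shows "meager_in (closure (range (\<lambda>\<delta>. shift \<delta> x))) (- Free)"
proof -
  let ?X = "closure (range (\<lambda>\<delta>. shift \<delta> x))"
  define A where "A \<gamma> = (if \<gamma> = 0 then {} else {y. shift \<gamma> y = y})" for \<gamma> :: 'g
  have "meager_in ?X (A \<gamma>)" for \<gamma>
  proof (rule meager_in_closed)
    show "closed (A \<gamma>)" by (simp add: A_def closed_shift_fixed)
    fix U assume "open U" "U \<inter> ?X \<noteq> {}"
    then obtain \<delta> where \<delta>: "shift \<delta> x \<in> U"
      using open_Int_closure_eq_empty[of U] by blast
    moreover have "shift \<delta> x \<notin> A \<gamma>"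
      using shift_in_Free[OF assms, of \<delta>] unfolding A_def Free_iff by auto
    ultimately show "\<not> U \<inter> ?X \<subseteq> A \<gamma>" using closure_subset[of "range (\<lambda>\<delta>. shift \<delta> x)"] by blast
  qed
  then have "meager_in ?X (\<Union>\<gamma>. A \<gamma>)" by (rule meager_in_UN)
  then show ?thesis
  proof (rule meager_in_subset)
    have "- Free \<subseteq> (\<Union>\<gamma>. A \<gamma>)"
    proof
      fix y :: "'g \<Rightarrow> bool" assume "y \<in> - Free"
      then obtain \<gamma> where "shift \<gamma> y = y" "\<gamma> \<noteq> 0" by (auto simp: Free_iff)
      then have "y \<in> A \<gamma>" by (simp add: A_def)
      then show "y \<in> (\<Union>\<gamma>. A \<gamma>)" by blast
    qed
    then show "- Free \<inter> ?X \<subseteq> (\<Union>\<gamma>. A \<gamma>)" by blast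
  qed
qed

lemma unbounded_card_beyond:
  fixes F :: "nat \<Rightarrow> 'a set"
  assumes "(SUP n. enat (card (F n))) = \<infinity>"
  shows "\<exists>n\<ge>n0. m \<le> card (F n)"
proof (rule ccontr)
  assume "\<not> (\<exists>n\<ge>n0. m \<le> card (F n))"
  then have late: "card (F n) \<le> m" if "n \<ge> n0" for n using that by (meson nat_le_linear)
  define M where "M = m + (\<Sum>k<n0. card (F k))"
  have "card (F n) \<le> M" for n
  proof (cases "n < n0")
    case True
    then have "card (F n) \<le> (\<Sum>k<n0. card (F k))" by (intro member_le_sum) auto
    then show ?thesis by (simp add: M_def)
  next
    case False
    then show ?thesis using late[of n] by (simp add: M_def)
  qed
  then have "(SUP n. enat (card (F n))) \<le> enat M" by (intro SUP_least) simp
  then show False using assms by simp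
qed

section \<open>Complete sections\<close>

text \<open>
  The demands are made for the translates \<open>\<delta> + F n\<close>, not only for \<open>F n\<close>: neighbourhoods of
  \<open>x\<close> alone would not suffice, since an open set meeting the orbit closure is only known to contain a shift of
  \<open>x\<close>. Recurrence passes from the orbit of \<open>x\<close> to its closure because it is a closed condition for fixed
  finite \<open>F n\<close> and \<open>W\<close>.
\<close>

lemma exists_universally_recurrent_point:
  fixes F :: "nat \<Rightarrow> 'g::{group_add, countable} set"
  assumes inf: "infinite (UNIV :: 'g set)" and fin: "\<And>n. finite (F n)"
    and large: "\<And>n0 m. \<exists>n\<ge>n0. m \<le> card (F n)"
  shows "\<exists>x\<in>Free. \<forall>W \<delta> n0. finite W \<longrightarrow> (\<exists>n\<ge>n0. \<forall>y\<in>closure (range (\<lambda>\<gamma>. shift \<gamma> x)).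
           \<exists>g\<in>F n. \<forall>d\<in>W. shift (\<delta> + g) y d = x d)"
proof -
  \<comment> \<open>Every pair \<open>(\<delta>, n0)\<close> is the task of infinitely many stages, so it is also treated when the pattern already covers a given \<open>W\<close>.\<close>
  define task :: "nat \<Rightarrow> 'g \<times> nat" where "task i = from_nat (snd (prod_decode i))" for i
  define \<F> where "\<F> i = {(+) (fst (task i)) ` F n | n. snd (task i) \<le> n}" for i
  have \<F>: "\<exists>E\<in>\<F> i. finite E \<and> m \<le> card E" for i m
  proof -
    obtain n where n: "snd (task i) \<le> n" "m \<le> card (F n)" using large by blast
    have "card ((+) (fst (task i)) ` F n) = card (F n)" by (intro card_image) (simp add: inj_on_def)
    then show ?thesis using n fin unfolding \<F>_def by (intro bexI[of _ "(+) (fst (task i)) ` F n"]) auto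
  qed
  obtain x :: "'g \<Rightarrow> bool" and D :: "nat \<Rightarrow> 'g set" where x: "x \<in> Free"
    and D: "\<And>i j. i \<le> j \<Longrightarrow> D i \<subseteq> D j" "\<And>h. \<exists>i. h \<in> D i"
    and rec: "\<And>i. \<exists>E\<in>\<F> i. \<forall>\<gamma>. \<exists>f\<in>E. \<forall>d\<in>D i. shift (f + \<gamma>) x d = x d"
    using exists_syndetically_recurrent_point[OF inf, of \<F>] \<F> by metis
  have main: "\<exists>n\<ge>n0. \<forall>y\<in>closure (range (\<lambda>\<gamma>. shift \<gamma> x)). \<exists>g\<in>F n. \<forall>d\<in>W. shift (\<delta> + g) y d = x d"
    if W: "finite W" for W \<delta> n0
  proof -
    obtain k where k: "W \<subseteq> D k"
    proof -
      obtain c where c: "\<And>h. h \<in> D (c h)" using D(2) by metis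
      have "h \<in> D (Max (c ` W))" if "h \<in> W" for h
      proof -
        have "c h \<le> Max (c ` W)" using W that by (intro Max_ge) auto
        then show ?thesis using c D(1) by blast
      qed
      then have "W \<subseteq> D (Max (c ` W))" by blast
      then show ?thesis by (rule that)
    qed
    define i where "i = prod_encode (k, to_nat (\<delta>, n0))"
    have task: "task i = (\<delta>, n0)" by (simp add: task_def i_def)
    have "k \<le> i" unfolding i_def by (rule le_prod_encode_1)
    then have Wi: "W \<subseteq> D i" using k D(1) by blast
    obtain E where E: "E \<in> \<F> i" "\<And>\<gamma>. \<exists>f\<in>E. \<forall>d\<in>D i. shift (f + \<gamma>) x d = x d" using rec by blast
    then obtain n where n: "n0 \<le> n" "E = (+) \<delta> ` F n" by (auto simp: \<F>_def task)
    define Y where "Y = (\<Union>g\<in>F n. \<Inter>d\<in>W. {y. y (d + (\<delta> + g)) = x d})"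
    have "closed Y"
      unfolding Y_def using fin by (intro closed_UN closed_INT ballI closed_Collect_coordinate) auto
    moreover have "shift \<gamma> x \<in> Y" for \<gamma>
    proof -
      obtain g where g: "g \<in> F n" "\<And>d. d \<in> D i \<Longrightarrow> shift (\<delta> + g + \<gamma>) x d = x d"
        using E(2)[of \<gamma>] n(2) by blast
      then have "shift \<gamma> x (d + (\<delta> + g)) = x d" if "d \<in> W" for d
        using Wi that by (simp add: shift_def add.assoc subset_iff)
      then show ?thesis using g(1) by (auto simp: Y_def)
    qed
    ultimately have "closure (range (\<lambda>\<gamma>. shift \<gamma> x)) \<subseteq> Y" by (intro closure_minimal) auto
    then have "\<forall>y\<in>closure (range (\<lambda>\<gamma>. shift \<gamma> x)). \<exists>g\<in>F n. \<forall>d\<in>W. shift (\<delta> + g) y d = x d"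
      unfolding Y_def shift_def by blast
    then show ?thesis using n(1) by blast
  qed
  show ?thesis by (intro bexI[OF _ x] allI impI main)
qed

theorem theorem1p18:
  fixes B :: "nat \<Rightarrow> ('g::{group_add, countable} \<Rightarrow> bool) set"
    and F :: "nat \<Rightarrow> 'g set"
  assumes "infinite (UNIV :: 'g set)"
    and "\<And>n. complete_section (B n)"
    and "\<And>n. B n \<in> sets (restrict_space borel Free)"
    and "\<And>n. finite (F n)"
    and "(SUP n. enat (card (F n))) = \<infinity>"
  shows "\<exists>x\<in>Free. infinite {n. x \<in> translates (F n) (B n)}"
proof (rule ccontr)
  assume contra: "\<not> ?thesis"
  have fin: "finite {n. z \<in> translates (F n) (B n)}" if "z \<in> Free" for z
  proof (rule ccontr)
    assume "infinite {n. z \<in> translates (F n) (B n)}"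
    then have "\<exists>x\<in>Free. infinite {n. x \<in> translates (F n) (B n)}" using that by (rule bexI)
    with contra show False by (rule notE)
  qed
  obtain x where x: "x \<in> Free"
    and rec: "\<forall>W \<delta> n0. finite W \<longrightarrow> (\<exists>n\<ge>n0. \<forall>y\<in>closure (range (\<lambda>\<gamma>. shift \<gamma> x)).
           \<exists>g\<in>F n. \<forall>d\<in>W. shift (\<delta> + g) y d = x d)"
    using exists_universally_recurrent_point[OF assms(1,4) unbounded_card_beyond[OF assms(5)]] by (elim bexE)
  define X where "X = closure (range (\<lambda>\<gamma>. shift \<gamma> x))"
  have orbit: "shift \<gamma> x \<in> X" for \<gamma>
    unfolding X_def by (rule subsetD[OF closure_subset rangeI])
  have inv: "shift \<gamma> y \<in> X" if "y \<in> X" for \<gamma> y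
    using that unfolding X_def by (rule shift_in_orbit_closure)
  have "compact (UNIV \<inter> X)"
    by (rule compact_Int_closed[OF compact_UNIV_bool_fun]) (simp add: X_def)
  then have compX: "compact X" by simp
  have notmeager: "\<not> meager_in X UNIV"
    using orbit[of 0] by (intro open_not_meager_in_compact Hausdorff_bool_fun compX) auto
  have nonfree: "meager_in X (- Free)"
    unfolding X_def by (rule meager_in_orbit_closure_not_Free[OF x])
  have borel: "B n \<in> sets borel" for n
    using assms(3)[of n] Free_borel by (auto simp: sets_restrict_space)
  define T where "T m = Free - (\<Union>n\<in>{m..}. translates (F n) (B n))" for m
  have T_borel: "T m \<in> sets borel" for m
    unfolding T_def using translates_borel[OF assms(4) borel]
    by (intro sets.Diff Free_borel sets.countable_UN') auto
  have "\<exists>m. \<not> meager_in X (T m)"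
  proof (rule ccontr)
    assume "\<nexists>m. \<not> meager_in X (T m)"
    then have "meager_in X (\<Union>m. T m)" by (intro meager_in_UN) blast
    then have "meager_in X (- Free \<union> (\<Union>m. T m))" by (rule meager_in_Un[OF nonfree])
    moreover have "z \<in> - Free \<union> (\<Union>m. T m)" for z
    proof (cases "z \<in> Free")
      case True
      obtain m where "\<And>n. z \<in> translates (F n) (B n) \<Longrightarrow> n < m"
        using fin[OF True] by (metis finite_nat_set_iff_bounded mem_Collect_eq)
      then have "z \<in> T m" using True unfolding T_def by fastforce
      then show ?thesis by blast
    qed simp
    then have "- Free \<union> (\<Union>m. T m) = UNIV" by blast
    ultimately show False using notmeager by simp
  qed
  then obtain m where "\<not> meager_in X (T m)" by blast
  then obtain O' where O': "open O'" "O' \<inter> X \<noteq> {}" "meager_in X (O' - T m)"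
    using borel_nonmeager_comeager_open[OF T_borel] by metis
  then obtain \<delta> where \<delta>: "shift \<delta> x \<in> O'"
    unfolding X_def using open_Int_closure_eq_empty[of O'] by blast
  obtain W where W: "finite W" "\<And>y. (\<And>d. d \<in> W \<Longrightarrow> y d = x d) \<Longrightarrow> y \<in> shift \<delta> -` O'"
    using open_contains_cylinder[OF open_shift_vimage[OF O'(1), of \<delta>], of x] \<delta> by auto
  obtain n where n: "m \<le> n" "\<And>y. y \<in> X \<Longrightarrow> \<exists>g\<in>F n. \<forall>d\<in>W. shift (- \<delta> + g) y d = x d"
    using rec[rule_format, OF W(1), of m "- \<delta>"] unfolding X_def by blast
  have hit: "\<exists>g\<in>F n. shift g y \<in> O'" if "y \<in> X" for y
  proof -
    obtain g where g: "g \<in> F n" "\<And>d. d \<in> W \<Longrightarrow> shift (- \<delta> + g) y d = x d" using n(2)[OF \<open>y \<in> X\<close>] by blast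
    then have "shift (\<delta> + (- \<delta> + g)) y \<in> O'" using W(2) by (simp only: vimage_eq shift_shift[symmetric])
    then show ?thesis using g(1) by auto
  qed
  have "meager_in X (- Free \<union> (\<Union>\<gamma>. shift \<gamma> -` (O' - T m)))" (is "meager_in X ?M")
    by (intro meager_in_Un nonfree meager_in_UN meager_in_shift_vimage inv O'(3))
  then have "\<not> UNIV \<inter> X \<subseteq> ?M" using notmeager meager_in_subset by metis
  then obtain z where "z \<in> X" "z \<notin> ?M" by blast
  then have z: "z \<in> X" "z \<in> Free" "shift \<gamma> z \<notin> O' - T m" for \<gamma> by auto
  have "z \<in> translates UNIV (B n)" using z(2) assms(2)[of n] by (simp add: complete_section_def)
  then obtain \<gamma> b where b: "b \<in> B n" "z = shift \<gamma> b" by (auto simp: translates_def)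
  then have b_eq: "b = shift (- \<gamma>) z" by (simp add: shift_shift shift_0)
  then have "b \<in> X" using inv z(1) by simp
  then obtain g where g: "g \<in> F n" "shift g b \<in> O'" using hit by blast
  have "shift g b \<in> T m" using z(3)[of "g + - \<gamma>"] g(2) by (simp add: b_eq shift_shift)
  then have "shift g b \<notin> translates (F n) (B n)" using n(1) by (auto simp: T_def)
  then show False using g(1) b(1) by (auto simp: translates_def)
qed

end
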